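(* Let $R>0$, $\rho\in(-1,1)$, $\rho\ne 0$, $a=\frac{R}{\sqrt{1-|\rho|}}$, $b=\frac{R}{\sqrt{1+|\rho|}}$, $q=\sqrt{\frac{a-b}{a+b}}\in(0,1)$ and $\hat\eta=-\log q>0$. Let $h:\mathbb{R}\to\mathbb{R}$ be a continuous $2\pi$-periodic function. Consider the following problem for a function $g(\eta,\varphi)$, $0\le\eta\le\hat\eta$, $2\pi$-periodic in $\varphi$: $$\begin{cases}\dfrac{\partial^2 g}{\partial\eta^2}+\dfrac{\partial^2 g}{\partial\varphi^2}=0, & \eta<\hat\eta,\\[2mm] g(\eta,\varphi)=h(\varphi), & \eta=\hat\eta,\\[1mm] \varphi\mapsto g(0,\varphi)\ \text{is an even function of }\varphi,\\[1mm] \varphi\mapsto\dfrac{\partial g}{\partial\eta}(\eta,\varphi)\Big|_{\eta=0}\ \text{is an odd function of }\varphi.\end{cases}$$ The general solution of this problem is $$g(\eta,\varphi)=\int_0^{2\pi}h(\tau)\left[\frac1{2\pi}+\frac1\pi\sum_{k=1}^{\infty}\left(\frac{\cosh k\eta}{\cosh k\hat\eta}\cos k\varphi\cos k\tau+\frac{\sinh k\eta}{\sinh k\hat\eta}\sin k\varphi\sin k\tau\right)\right]d\tau .$$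
   Context: The problem is understood in the classical sense: $g$ is continuous on $0\le\eta\le\hat\eta$, twice continuously differentiable and satisfies the equation for $0<\eta<\hat\eta$, and is continuously differentiable up to $\eta=0$. The integral formula is evaluated for $0\le\eta<\hat\eta$, and the boundary condition at $\eta=\hat\eta$ is attained as the limit $\eta\to\hat\eta^-$. *)

theory Defs
  imports "HOL-Analysis.Analysis"
begin

text \<open>
  On the strip \<open>I \<times> \<real>\<close> the function \<open>f\<close> has the continuous partial derivatives
  \<open>f\<^sub>\<eta>\<close> and \<open>f\<^sub>\<phi>\<close>. At an end point belonging to \<open>I\<close> the derivative in \<open>\<eta>\<close> is
  one-sided, so values of \<open>f\<close> outside the strip are irrelevant.
\<close>
definition has_continuous_partials ::
  "real set \<Rightarrow> (real \<Rightarrow> real \<Rightarrow> real) \<Rightarrow> (real \<Rightarrow> real \<Rightarrow> real) \<Rightarrow> (real \<Rightarrow> real \<Rightarrow> real) \<Rightarrow> bool"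
  where
  "has_continuous_partials I f f\<^sub>\<eta> f\<^sub>\<phi> \<longleftrightarrow>
     (\<forall>\<eta>\<in>I. \<forall>\<phi>.
        ((\<lambda>s. f s \<phi>) has_real_derivative f\<^sub>\<eta> \<eta> \<phi>) (at \<eta> within I) \<and>
        ((\<lambda>t. f \<eta> t) has_real_derivative f\<^sub>\<phi> \<eta> \<phi>) (at \<phi>)) \<and>
     continuous_on (I \<times> UNIV) (\<lambda>(\<eta>, \<phi>). f\<^sub>\<eta> \<eta> \<phi>) \<and>
     continuous_on (I \<times> UNIV) (\<lambda>(\<eta>, \<phi>). f\<^sub>\<phi> \<eta> \<phi>)"

text \<open>
  Classical solutions: continuous on the closed strip, \<open>C\<^sup>1\<close> up to \<open>\<eta> = 0\<close>, and
  \<open>C\<^sup>2\<close> in the open strip. Together with continuity on the closed strip, the condition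
  \<open>g \<eta>hat \<phi> = h \<phi>\<close> says that the boundary values at \<open>\<eta>hat\<close> are attained as limits from
  the left. The partial derivatives are uniquely determined by \<open>g\<close> on the sets on which
  they are constrained.
\<close>
definition classical_solution ::
  "real \<Rightarrow> (real \<Rightarrow> real) \<Rightarrow> (real \<Rightarrow> real \<Rightarrow> real) \<Rightarrow> bool"
  where
  "classical_solution \<eta>hat h g \<longleftrightarrow>
     (\<exists>g\<^sub>\<eta> g\<^sub>\<phi> g\<^sub>\<eta>\<^sub>\<eta> g\<^sub>\<eta>\<^sub>\<phi> g\<^sub>\<phi>\<^sub>\<eta> g\<^sub>\<phi>\<^sub>\<phi>.
        continuous_on ({0..\<eta>hat} \<times> UNIV) (\<lambda>(\<eta>, \<phi>). g \<eta> \<phi>) \<and>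
        (\<forall>\<eta>\<in>{0..\<eta>hat}. \<forall>\<phi>. g \<eta> (\<phi> + 2 * pi) = g \<eta> \<phi>) \<and>
        has_continuous_partials {0..<\<eta>hat} g g\<^sub>\<eta> g\<^sub>\<phi> \<and>
        has_continuous_partials {0<..<\<eta>hat} g\<^sub>\<eta> g\<^sub>\<eta>\<^sub>\<eta> g\<^sub>\<eta>\<^sub>\<phi> \<and>
        has_continuous_partials {0<..<\<eta>hat} g\<^sub>\<phi> g\<^sub>\<phi>\<^sub>\<eta> g\<^sub>\<phi>\<^sub>\<phi> \<and>
        (\<forall>\<eta>\<in>{0<..<\<eta>hat}. \<forall>\<phi>. g\<^sub>\<eta>\<^sub>\<eta> \<eta> \<phi> + g\<^sub>\<phi>\<^sub>\<phi> \<eta> \<phi> = 0) \<and>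
        (\<forall>\<phi>. g \<eta>hat \<phi> = h \<phi>) \<and>
        (\<forall>\<phi>. g 0 (- \<phi>) = g 0 \<phi>) \<and>
        (\<forall>\<phi>. g\<^sub>\<eta> 0 (- \<phi>) = - g\<^sub>\<eta> 0 \<phi>))"

definition kernel_term :: "real \<Rightarrow> real \<Rightarrow> real \<Rightarrow> real \<Rightarrow> nat \<Rightarrow> real"
  where
  "kernel_term \<eta>hat \<eta> \<phi> \<tau> k =
     cosh (real k * \<eta>) / cosh (real k * \<eta>hat) * cos (real k * \<phi>) * cos (real k * \<tau>) +
     sinh (real k * \<eta>) / sinh (real k * \<eta>hat) * sin (real k * \<phi>) * sin (real k * \<tau>)"

text \<open>The series starts at \<open>k = 1\<close>, hence the index shift by \<^const>\<open>Suc\<close>.\<close>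
definition strip_kernel :: "real \<Rightarrow> real \<Rightarrow> real \<Rightarrow> real \<Rightarrow> real"
  where
  "strip_kernel \<eta>hat \<eta> \<phi> \<tau> =
     1 / (2 * pi) + 1 / pi * (\<Sum>n. kernel_term \<eta>hat \<eta> \<phi> \<tau> (Suc n))"

end

theory Submission
  imports Defs "HOL-Complex_Analysis.Complex_Analysis"
begin

text \<open>
  Write \<open>L\<close> for \<open>\<eta>hat\<close>. Reflecting a solution by \<open>g (- \<eta>) (- \<phi>) = g \<eta> \<phi>\<close> turns the parity
  conditions at \<open>\<eta> = 0\<close> into regularity across \<open>\<eta> = 0\<close>: the problem is the Dirichlet problem in
  the strip \<open>\<bar>\<eta>\<bar> < L\<close> with the data \<open>h \<phi>\<close> at \<open>L\<close> and \<open>h (- \<phi>)\<close> at \<open>- L\<close>. The map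
  \<open>w = exp (\<eta> + \<i> \<phi>)\<close> makes the strip, taken modulo \<open>2 \<pi>\<close> in \<open>\<phi>\<close>, an annulus.

  Existence rests on two representations of the integral \<open>kernel_integral L h\<close>. Integrating the
  series termwise shows that it is the real part of the function
  \<open>c\<^sub>0 + \<Sum> c\<^sub>k cosh (k z)\<close> of \<open>z = \<eta> + \<i> \<phi>\<close>, where \<open>\<bar>c\<^sub>k\<bar>\<close> is at most a multiple of \<open>exp (- k L)\<close>
  (\<open>kernel_integral_eq_Re_potential\<close>). This function is holomorphic in the strip, even, and
  \<open>2 \<pi> \<i>\<close>-periodic, and these three properties give the equation and the interior
  regularity, the two parity conditions, and the periodicity in \<open>\<phi>\<close>.

  The boundary values at \<open>L\<close> are not visible in that series. For a trigonometric
  polynomial \<open>P\<close> the series is finite and has the boundary values \<open>P\<close>, and the maximum principle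
  in the annulus bounds it by the maximum of \<open>\<bar>P\<bar>\<close>. Trigonometric polynomials are dense
  (\<open>trig_polys_dense\<close>), so the bound holds for every continuous periodic function
  (\<open>kernel_integral_bound\<close>). Hence uniform approximation of \<open>h\<close> by trigonometric polynomials
  approximates \<open>kernel_integral L h\<close> uniformly in the whole strip by functions continuous on its
  closure (\<open>kernel_integral_extends_continuously\<close>).

  Uniqueness (\<open>classical_solution_zero\<close>) is an energy argument. For a solution \<open>u\<close> with
  \<open>h = 0\<close> let \<open>E \<eta>\<close> be the integral of \<open>(u \<eta> \<phi>)\<^sup>2\<close> over one period. By the equation \<open>E\<close> is
  convex, and \<open>E' 0 = 0\<close> because an even times an odd function is integrated. So \<open>E\<close> increases
  from a nonnegative value to \<open>E L = 0\<close>, and \<open>u = 0\<close>.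
\<close>

section \<open>Decay of the kernel and the integral transform\<close>

definition kernel_integral :: "real \<Rightarrow> (real \<Rightarrow> real) \<Rightarrow> real \<Rightarrow> real \<Rightarrow> real" where
  "kernel_integral L h \<eta> \<phi> = integral {0..2 * pi} (\<lambda>\<tau>. h \<tau> * strip_kernel L \<eta> \<phi> \<tau>)"

definition fourier_cos :: "(real \<Rightarrow> real) \<Rightarrow> nat \<Rightarrow> real" where
  "fourier_cos h k = integral {0..2 * pi} (\<lambda>\<tau>. h \<tau> * cos (real k * \<tau>))"

definition fourier_sin :: "(real \<Rightarrow> real) \<Rightarrow> nat \<Rightarrow> real" where
  "fourier_sin h k = integral {0..2 * pi} (\<lambda>\<tau>. h \<tau> * sin (real k * \<tau>))"

text \<open>
  The hyperbolic denominators satisfy \<open>1 / cosh (k L) \<le> 2 exp (- k L)\<close>, but for \<open>sinh\<close> a factor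
  that blows up as \<open>L\<close> tends to \<open>0\<close> is unavoidable. This constant serves for both.
\<close>

definition decay_const :: "real \<Rightarrow> real" where
  "decay_const L = 2 / (1 - exp (- 2 * L))"

lemma decay_const_pos: "L > 0 \<Longrightarrow> decay_const L > 0"
  by (simp add: decay_const_def)

lemma inverse_sinh_cosh_le:
  assumes L: "L > 0" and k: "k \<ge> 1"
  shows "1 / cosh (real k * L) \<le> decay_const L * exp (- real k * L)"
    and "1 / sinh (real k * L) \<le> decay_const L * exp (- real k * L)"
proof -
  define x where "x = real k * L"
  have x: "L \<le> x" "x > 0" using assms by (auto simp: x_def)
  have e: "exp (- 2 * x) \<le> exp (- 2 * L)" using x by simp
  have E: "exp (- 2 * L) < 1" using L by simp
  have "exp x * (1 - exp (- 2 * L)) \<le> exp x * (1 - exp (- 2 * x))"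
    using e by (intro mult_left_mono) auto
  also have "\<dots> = 2 * sinh x"
    by (simp add: sinh_def algebra_simps flip: exp_add)
  finally have s: "exp x * (1 - exp (- 2 * L)) \<le> 2 * sinh x" .
  have sc: "sinh x \<le> cosh x" "sinh x > 0" using x
    by (auto simp: sinh_le_cosh_real)
  have "1 / y \<le> decay_const L * exp (- x)" if y: "sinh x \<le> y" for y
  proof -
    have y0: "y > 0" using less_le_trans[OF sc(2) y] .
    have "1 = exp x * exp (- x)" by (simp flip: exp_add)
    also have "exp x \<le> decay_const L * y"
      using s y E L by (simp add: decay_const_def field_simps)
    finally show ?thesis using y0 by (simp add: field_simps)
  qed
  from this[of "cosh x"] this[of "sinh x"] sc
  show "1 / cosh (real k * L) \<le> decay_const L * exp (- real k * L)"
    and "1 / sinh (real k * L) \<le> decay_const L * exp (- real k * L)"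
    by (auto simp: x_def)
qed

text \<open>
  The decay in \<open>k\<close> is geometric with the ratio \<open>exp (\<eta> - L)\<close>, which is less than \<open>1\<close> exactly
  for \<open>\<eta> < L\<close>. This makes the kernel a uniformly convergent series for each fixed \<open>\<eta> < L\<close>.
\<close>

lemma hyperbolic_quotient_le:
  assumes L: "L > 0" and k: "k \<ge> 1" and \<eta>: "0 \<le> \<eta>"
  shows "\<bar>cosh (real k * \<eta>) / cosh (real k * L)\<bar> \<le> decay_const L * exp (- (L - \<eta>)) ^ k"
    and "\<bar>sinh (real k * \<eta>) / sinh (real k * L)\<bar> \<le> decay_const L * exp (- (L - \<eta>)) ^ k"
proof -
  have p: "real k * \<eta> \<ge> 0" "real k * L > 0" using assms by auto
  have s: "sinh (real k * \<eta>) \<le> exp (real k * \<eta>)" "cosh (real k * \<eta>) \<le> exp (real k * \<eta>)"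
    "sinh (real k * \<eta>) \<ge> 0" "cosh (real k * \<eta>) \<ge> 0"
    using p cosh_plus_sinh[of "real k * \<eta>"] cosh_real_nonneg[of "real k * \<eta>"]
      sinh_real_nonneg_iff[of "real k * \<eta>"] by linarith+
  have eq: "exp (real k * \<eta>) * (decay_const L * exp (- real k * L))
      = decay_const L * exp (- (L - \<eta>)) ^ k"
    by (simp add: exp_of_nat_mult[symmetric] algebra_simps flip: exp_add)
  show "\<bar>cosh (real k * \<eta>) / cosh (real k * L)\<bar> \<le> decay_const L * exp (- (L - \<eta>)) ^ k"
    using mult_mono[OF s(2) inverse_sinh_cosh_le(1)[OF L k]] s unfolding eq[symmetric]
    by (simp add: abs_mult)
  show "\<bar>sinh (real k * \<eta>) / sinh (real k * L)\<bar> \<le> decay_const L * exp (- (L - \<eta>)) ^ k"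
    using mult_mono[OF s(1) inverse_sinh_cosh_le(2)[OF L k]] s p unfolding eq[symmetric]
    by (simp add: abs_mult)
qed

lemma kernel_term_bound:
  assumes L: "L > 0" and k: "k \<ge> 1" and \<eta>: "0 \<le> \<eta>"
  shows "\<bar>kernel_term L \<eta> \<phi> \<tau> k\<bar> \<le> 2 * decay_const L * exp (- (L - \<eta>)) ^ k"
proof -
  have t: "\<bar>x * u * v\<bar> \<le> B" if "\<bar>x\<bar> \<le> B" "\<bar>u\<bar> \<le> 1" "\<bar>v\<bar> \<le> 1" for x u v B :: real
  proof -
    have "\<bar>x * u * v\<bar> \<le> \<bar>x\<bar> * 1 * 1"
      unfolding abs_mult using that by (intro mult_mono) auto
    then show ?thesis using that by simp
  qed
  show ?thesis
    unfolding kernel_term_def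
    using t[OF hyperbolic_quotient_le(1)[OF L k \<eta>], of "cos (real k * \<phi>)" "cos (real k * \<tau>)"]
      t[OF hyperbolic_quotient_le(2)[OF L k \<eta>], of "sin (real k * \<phi>)" "sin (real k * \<tau>)"]
    by (intro order_trans[OF abs_triangle_ineq]) simp
qed

lemma summable_decay:
  fixes \<eta> L B :: real
  assumes "\<eta> < L"
  shows "summable (\<lambda>n. B * exp (- (L - \<eta>)) ^ Suc n)"
proof -
  have "summable (\<lambda>n. B * exp (- (L - \<eta>)) ^ n)"
    by (rule summable_mult, rule summable_geometric) (use assms in auto)
  then show ?thesis
    using summable_Suc_iff[of "\<lambda>n. B * exp (- (L - \<eta>)) ^ n"] by blast
qed

lemma kernel_summable:
  assumes "L > 0" "0 \<le> \<eta>" "\<eta> < L"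
  shows "summable (\<lambda>n. kernel_term L \<eta> \<phi> \<tau> (Suc n))"
  by (rule summable_comparison_test'[OF summable_decay[OF assms(3)], of 0])
     (unfold real_norm_def, rule kernel_term_bound, use assms in auto)

lemma kernel_uniform_limit:
  assumes "L > 0" "0 \<le> \<eta>" "\<eta> < L"
  shows "uniform_limit UNIV (\<lambda>N \<tau>. \<Sum>n<N. kernel_term L \<eta> \<phi> \<tau> (Suc n))
           (\<lambda>\<tau>. \<Sum>n. kernel_term L \<eta> \<phi> \<tau> (Suc n)) sequentially"
  by (rule Weierstrass_m_test[OF _ summable_decay[OF assms(3)]])
     (unfold real_norm_def, rule kernel_term_bound, use assms in auto)

lemma continuous_kernel_term: "continuous_on A (\<lambda>\<tau>. kernel_term L \<eta> \<phi> \<tau> k)"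
  unfolding kernel_term_def by (intro continuous_intros)

lemma continuous_strip_kernel:
  assumes "L > 0" "0 \<le> \<eta>" "\<eta> < L"
  shows "continuous_on A (\<lambda>\<tau>. strip_kernel L \<eta> \<phi> \<tau>)"
proof -
  have "continuous_on UNIV (\<lambda>\<tau>. \<Sum>n. kernel_term L \<eta> \<phi> \<tau> (Suc n))"
    by (rule uniform_limit_theorem[OF _ kernel_uniform_limit[OF assms]])
       (auto intro!: always_eventually continuous_intros continuous_kernel_term)
  then show ?thesis
    unfolding strip_kernel_def
    by (intro continuous_intros) (auto intro: continuous_on_subset)
qed

lemma kernel_integrable:
  assumes "L > 0" "0 \<le> \<eta>" "\<eta> < L" "continuous_on UNIV h"
  shows "(\<lambda>\<tau>. h \<tau> * strip_kernel L \<eta> \<phi> \<tau>) integrable_on {0..2 * pi}"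
  by (intro integrable_continuous_interval continuous_intros continuous_strip_kernel)
     (use assms in \<open>auto intro: continuous_on_subset\<close>)

lemma kernel_integral_add:
  assumes "L > 0" "0 \<le> \<eta>" "\<eta> < L" "continuous_on UNIV f" "continuous_on UNIV g"
  shows "kernel_integral L (\<lambda>x. f x + g x) \<eta> \<phi> = kernel_integral L f \<eta> \<phi> + kernel_integral L g \<eta> \<phi>"
  unfolding kernel_integral_def distrib_right
  by (intro integral_add kernel_integrable assms)

lemma kernel_integral_scale:
  "kernel_integral L (\<lambda>x. c * f x) \<eta> \<phi> = c * kernel_integral L f \<eta> \<phi>"
  unfolding kernel_integral_def mult.assoc by simp

text \<open>
  The constant depends on \<open>\<eta>\<close> and may blow up at \<open>\<eta> = L\<close>. It serves to pass to the limit at a fixed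
  point of the strip; the maximum principle later replaces it by \<open>1\<close>.
\<close>

lemma kernel_integral_crude_bound:
  assumes "L > 0" "0 \<le> \<eta>" "\<eta> < L"
  obtains C where "C > 0"
    "\<And>f \<epsilon>. continuous_on UNIV f \<Longrightarrow> (\<And>x. \<bar>f x\<bar> \<le> \<epsilon>) \<Longrightarrow> \<bar>kernel_integral L f \<eta> \<phi>\<bar> \<le> \<epsilon> * C"
proof -
  have "compact ((\<lambda>\<tau>. strip_kernel L \<eta> \<phi> \<tau>) ` {0..2 * pi})"
    by (intro compact_continuous_image continuous_strip_kernel assms) auto
  then obtain K where K: "K > 0" "\<And>\<tau>. \<tau> \<in> {0..2 * pi} \<Longrightarrow> \<bar>strip_kernel L \<eta> \<phi> \<tau>\<bar> \<le> K"
    by (metis (no_types, lifting) bounded_pos compact_imp_bounded image_eqI real_norm_def)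
  show ?thesis
  proof
    show "K * (2 * pi) > 0" using K by simp
    fix f :: "real \<Rightarrow> real" and \<epsilon>
    assume f: "continuous_on UNIV f" "\<And>x. \<bar>f x\<bar> \<le> \<epsilon>"
    have "\<epsilon> \<ge> 0" using f(2)[of 0] by linarith
    have "norm (integral {0..2 * pi} (\<lambda>\<tau>. f \<tau> * strip_kernel L \<eta> \<phi> \<tau>)) \<le> (\<epsilon> * K) * (2 * pi - 0)"
    proof (rule integral_bound)
      show "continuous_on {0..2 * pi} (\<lambda>\<tau>. f \<tau> * strip_kernel L \<eta> \<phi> \<tau>)"
        by (intro continuous_intros continuous_strip_kernel assms)
           (use f in \<open>auto intro: continuous_on_subset\<close>)
      show "norm (f t * strip_kernel L \<eta> \<phi> t) \<le> \<epsilon> * K" if "t \<in> {0..2 * pi}" for t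
        unfolding real_norm_def abs_mult
        by (intro mult_mono f K that) (use \<open>\<epsilon> \<ge> 0\<close> in auto)
    qed auto
    then show "\<bar>kernel_integral L f \<eta> \<phi>\<bar> \<le> \<epsilon> * (K * (2 * pi))"
      by (simp add: kernel_integral_def mult.assoc)
  qed
qed

text \<open>
  The kernel series converges uniformly in \<open>\<tau>\<close>, so it may be integrated term by term.
\<close>

lemma kernel_integral_sums:
  assumes L: "L > 0" "0 \<le> \<eta>" "\<eta> < L" and h: "continuous_on UNIV h"
  shows "(\<lambda>n. 1 / pi * (cosh (real (Suc n) * \<eta>) / cosh (real (Suc n) * L) * cos (real (Suc n) * \<phi>) * fourier_cos h (Suc n)
                + sinh (real (Suc n) * \<eta>) / sinh (real (Suc n) * L) * sin (real (Suc n) * \<phi>) * fourier_sin h (Suc n)))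
          sums (kernel_integral L h \<eta> \<phi> - fourier_cos h 0 / (2 * pi))"
proof -
  let ?K = "\<lambda>\<tau>. \<Sum>n. kernel_term L \<eta> \<phi> \<tau> (Suc n)"
  let ?k = "\<lambda>n \<tau>. kernel_term L \<eta> \<phi> \<tau> (Suc n)"
  have hc [continuous_intros]: "continuous_on A h" for A
    using h continuous_on_subset by blast
  note [continuous_intros] = continuous_kernel_term
  \<comment> \<open>In each term the variable \<open>\<tau>\<close> is separated from \<open>\<eta>\<close> and \<open>\<phi>\<close>, which leaves the Fourier coefficients of \<open>h\<close>.\<close>
  have int: "integral {0..2 * pi} (\<lambda>\<tau>. h \<tau> * ?k n \<tau>) =
      cosh (real (Suc n) * \<eta>) / cosh (real (Suc n) * L) * cos (real (Suc n) * \<phi>) * fourier_cos h (Suc n)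
      + sinh (real (Suc n) * \<eta>) / sinh (real (Suc n) * L) * sin (real (Suc n) * \<phi>) * fourier_sin h (Suc n)"
    (is "_ = ?A * fourier_cos h (Suc n) + ?B * fourier_sin h (Suc n)") for n
  proof -
    define a b where ab: "a = ?A" "b = ?B"
    have "integral {0..2 * pi} (\<lambda>\<tau>. h \<tau> * ?k n \<tau>)
      = integral {0..2 * pi} (\<lambda>\<tau>. a * (h \<tau> * cos (real (Suc n) * \<tau>)) + b * (h \<tau> * sin (real (Suc n) * \<tau>)))"
      unfolding kernel_term_def ab by (intro arg_cong[where f = "integral _"] ext) argo
    also have "\<dots> = a * fourier_cos h (Suc n) + b * fourier_sin h (Suc n)"
      unfolding fourier_cos_def fourier_sin_def
      by (subst integral_add) (auto intro!: integrable_continuous_interval continuous_intros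
           simp del: of_nat_Suc)
    finally show ?thesis unfolding ab .
  qed
  have bh: "bounded (h ` {0..2 * pi})"
    by (intro compact_imp_bounded compact_continuous_image continuous_intros) auto
  have bK: "bounded (?K ` {0..2 * pi})"
  proof (intro compact_imp_bounded compact_continuous_image)
    have "continuous_on {0..2 * pi} (\<lambda>\<tau>. (strip_kernel L \<eta> \<phi> \<tau> - 1 / (2 * pi)) * pi)"
      by (intro continuous_intros continuous_strip_kernel L)
    then show "continuous_on {0..2 * pi} ?K" by (simp add: strip_kernel_def)
  qed auto
  have "uniform_limit {0..2 * pi} (\<lambda>N \<tau>. h \<tau> * (\<Sum>n<N. ?k n \<tau>)) (\<lambda>\<tau>. h \<tau> * ?K \<tau>) sequentially"
    by (intro uniform_lim_mult bh bK uniform_limit_const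
         uniform_limit_on_subset[OF kernel_uniform_limit[OF L]] subset_UNIV)
  then obtain I J where IJ: "\<And>N. ((\<lambda>\<tau>. h \<tau> * (\<Sum>n<N. ?k n \<tau>)) has_integral I N) {0..2 * pi}"
      "((\<lambda>\<tau>. h \<tau> * ?K \<tau>) has_integral J) {0..2 * pi}" "I \<longlonglongrightarrow> J"
    by (rule uniform_limit_integral) (auto intro!: continuous_intros)
  have I: "I N = (\<Sum>n<N. integral {0..2 * pi} (\<lambda>\<tau>. h \<tau> * ?k n \<tau>))" for N
  proof -
    have "I N = integral {0..2 * pi} (\<lambda>\<tau>. \<Sum>n<N. h \<tau> * ?k n \<tau>)"
      using IJ(1)[of N] by (simp add: integral_unique sum_distrib_left)
    also have "\<dots> = (\<Sum>n<N. integral {0..2 * pi} (\<lambda>\<tau>. h \<tau> * ?k n \<tau>))"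
      by (intro integral_sum) (auto intro!: integrable_continuous_interval continuous_intros)
    finally show ?thesis .
  qed
  have "(\<lambda>n. integral {0..2 * pi} (\<lambda>\<tau>. h \<tau> * ?k n \<tau>)) sums J"
    using IJ(3) unfolding sums_def I .
  then have S: "(\<lambda>n. 1 / pi * integral {0..2 * pi} (\<lambda>\<tau>. h \<tau> * ?k n \<tau>)) sums (1 / pi * J)"
    by (rule sums_mult)
  have "(h has_integral fourier_cos h 0) {0..2 * pi}"
    unfolding fourier_cos_def
    by (auto intro!: integrable_integral integrable_continuous_interval continuous_intros)
  then have "((\<lambda>\<tau>. 1 / (2 * pi) * h \<tau> + 1 / pi * (h \<tau> * ?K \<tau>)) has_integral
      (1 / (2 * pi) * fourier_cos h 0 + 1 / pi * J)) {0..2 * pi}"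
    by (intro has_integral_add has_integral_mult_right IJ(2))
  then have "kernel_integral L h \<eta> \<phi> = 1 / (2 * pi) * fourier_cos h 0 + 1 / pi * J"
    unfolding kernel_integral_def strip_kernel_def
    by (intro integral_unique) (simp add: algebra_simps)
  then have "1 / pi * J = kernel_integral L h \<eta> \<phi> - fourier_cos h 0 / (2 * pi)"
    by simp
  with S show ?thesis unfolding int by simp
qed

section \<open>Uniqueness by an energy estimate\<close>

lemma has_continuous_partials_diff:
  assumes "has_continuous_partials I f fx fy" "has_continuous_partials I g gx gy"
  shows "has_continuous_partials I (\<lambda>x y. f x y - g x y) (\<lambda>x y. fx x y - gx x y) (\<lambda>x y. fy x y - gy x y)"
  using assms unfolding has_continuous_partials_def
  by (auto intro!: derivative_intros simp: split_beta' continuous_on_diff)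

lemma classical_solution_diff:
  assumes "classical_solution L h1 f" "classical_solution L h2 g"
  shows "classical_solution L (\<lambda>x. h1 x - h2 x) (\<lambda>\<eta> \<phi>. f \<eta> \<phi> - g \<eta> \<phi>)"
proof -
  obtain fx fy fxx fxy fyx fyy where f:
    "continuous_on ({0..L} \<times> UNIV) (\<lambda>(\<eta>, \<phi>). f \<eta> \<phi>)"
    "\<forall>\<eta>\<in>{0..L}. \<forall>\<phi>. f \<eta> (\<phi> + 2 * pi) = f \<eta> \<phi>"
    "has_continuous_partials {0..<L} f fx fy"
    "has_continuous_partials {0<..<L} fx fxx fxy"
    "has_continuous_partials {0<..<L} fy fyx fyy"
    "\<forall>\<eta>\<in>{0<..<L}. \<forall>\<phi>. fxx \<eta> \<phi> + fyy \<eta> \<phi> = 0"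
    "\<forall>\<phi>. f L \<phi> = h1 \<phi>" "\<forall>\<phi>. f 0 (- \<phi>) = f 0 \<phi>" "\<forall>\<phi>. fx 0 (- \<phi>) = - fx 0 \<phi>"
    using assms(1) unfolding classical_solution_def by blast
  obtain gx gy gxx gxy gyx gyy where g:
    "continuous_on ({0..L} \<times> UNIV) (\<lambda>(\<eta>, \<phi>). g \<eta> \<phi>)"
    "\<forall>\<eta>\<in>{0..L}. \<forall>\<phi>. g \<eta> (\<phi> + 2 * pi) = g \<eta> \<phi>"
    "has_continuous_partials {0..<L} g gx gy"
    "has_continuous_partials {0<..<L} gx gxx gxy"
    "has_continuous_partials {0<..<L} gy gyx gyy"
    "\<forall>\<eta>\<in>{0<..<L}. \<forall>\<phi>. gxx \<eta> \<phi> + gyy \<eta> \<phi> = 0"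
    "\<forall>\<phi>. g L \<phi> = h2 \<phi>" "\<forall>\<phi>. g 0 (- \<phi>) = g 0 \<phi>" "\<forall>\<phi>. gx 0 (- \<phi>) = - gx 0 \<phi>"
    using assms(2) unfolding classical_solution_def by blast
  show ?thesis
    unfolding classical_solution_def
  proof (intro exI conjI)
    show "continuous_on ({0..L} \<times> UNIV) (\<lambda>(\<eta>, \<phi>). f \<eta> \<phi> - g \<eta> \<phi>)"
      using continuous_on_diff[OF f(1) g(1)] by (simp add: split_beta')
    show "has_continuous_partials {0..<L} (\<lambda>\<eta> \<phi>. f \<eta> \<phi> - g \<eta> \<phi>)
        (\<lambda>\<eta> \<phi>. fx \<eta> \<phi> - gx \<eta> \<phi>) (\<lambda>\<eta> \<phi>. fy \<eta> \<phi> - gy \<eta> \<phi>)"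
      "has_continuous_partials {0<..<L} (\<lambda>\<eta> \<phi>. fx \<eta> \<phi> - gx \<eta> \<phi>)
        (\<lambda>\<eta> \<phi>. fxx \<eta> \<phi> - gxx \<eta> \<phi>) (\<lambda>\<eta> \<phi>. fxy \<eta> \<phi> - gxy \<eta> \<phi>)"
      "has_continuous_partials {0<..<L} (\<lambda>\<eta> \<phi>. fy \<eta> \<phi> - gy \<eta> \<phi>)
        (\<lambda>\<eta> \<phi>. fyx \<eta> \<phi> - gyx \<eta> \<phi>) (\<lambda>\<eta> \<phi>. fyy \<eta> \<phi> - gyy \<eta> \<phi>)"
      using f g by (auto intro: has_continuous_partials_diff)
    show "\<forall>\<eta>\<in>{0<..<L}. \<forall>\<phi>. fxx \<eta> \<phi> - gxx \<eta> \<phi> + (fyy \<eta> \<phi> - gyy \<eta> \<phi>) = 0"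
    proof (intro ballI allI)
      fix \<eta> \<phi> assume "\<eta> \<in> {0<..<L}"
      then have "fxx \<eta> \<phi> + fyy \<eta> \<phi> = 0" "gxx \<eta> \<phi> + gyy \<eta> \<phi> = 0" using f(6) g(6) by blast+
      then show "fxx \<eta> \<phi> - gxx \<eta> \<phi> + (fyy \<eta> \<phi> - gyy \<eta> \<phi>) = 0" by linarith
    qed
  qed (use f g in auto)
qed

lemma periodic_representative:
  fixes f :: "real \<Rightarrow> 'a"
  assumes "\<And>x. f (x + 2 * pi) = f x"
  obtains t where "t \<in> {0..2 * pi}" "f x = f t"
proof -
  interpret f: periodic_fun_simple f "2 * pi" by standard (rule assms)
  define m where "m = \<lfloor>x / (2 * pi)\<rfloor>"
  define t where "t = x - of_int m * (2 * pi)"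
  have m: "of_int m \<le> x / (2 * pi)" "x / (2 * pi) \<le> of_int m + 1"
    unfolding m_def by linarith+
  have "0 < 2 * pi" by simp
  note m [unfolded pos_le_divide_eq[OF this] pos_divide_le_eq[OF this]]
  then have "t \<in> {0..2 * pi}"
    by (simp add: t_def algebra_simps)
  moreover have "f x = f t"
    using f.plus_of_int[of t m] by (simp add: t_def)
  ultimately show thesis by (rule that)
qed

lemma integral_odd_periodic:
  fixes f :: "real \<Rightarrow> real"
  assumes "\<And>x. f (- x) = - f x" "\<And>x. f (x + 2 * pi) = f x"
  shows "integral {0..2 * pi} f = 0"
proof -
  have "integral {0..2 * pi} f = integral {- (2 * pi) .. - 0} (\<lambda>x. f (- x))"
    by (rule Henstock_Kurzweil_Integration.integral_reflect_real[symmetric])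
  also have "\<dots> = integral {- (2 * pi)..0} (\<lambda>x. - f (x + 2 * pi))"
    using assms by simp
  also have "\<dots> = - integral {- (2 * pi)..0} (f \<circ> (\<lambda>x. x + 2 * pi))"
    by (simp add: o_def)
  also have "integral {- (2 * pi)..0} (f \<circ> (\<lambda>x. x + 2 * pi)) = integral {0..2 * pi} f"
    using integral_shift_real_ivl[of 0 "2 * pi" "2 * pi" f] by (simp add: o_def)
  finally show ?thesis by simp
qed

text \<open>
  The energy argument. Differentiating \<open>E = \<integral> u\<^sup>2\<close> twice in the open strip gives
  \<open>E'' = 2 \<integral> (u\<^sub>\<eta>\<^sup>2 + u u\<^sub>\<eta>\<^sub>\<eta>)\<close>, and by the equation and integration by parts over a
  period \<open>E'' = 2 \<integral> (u\<^sub>\<eta>\<^sup>2 + u\<^sub>\<phi>\<^sup>2) \<ge> 0\<close>. Together with \<open>E' 0 = 0\<close> this makes \<open>E\<close> nondecreasing.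
\<close>

lemma classical_solution_zero:
  assumes L: "L > 0" and u: "classical_solution L (\<lambda>_. 0) u" and \<eta>0: "\<eta>0 \<in> {0..L}"
  shows "u \<eta>0 \<phi> = 0"
proof -
  obtain ux uy uxx uxy uyx uyy where
    cont: "continuous_on ({0..L} \<times> UNIV) (\<lambda>(\<eta>, \<phi>). u \<eta> \<phi>)"
    and per: "\<forall>\<eta>\<in>{0..L}. \<forall>\<phi>. u \<eta> (\<phi> + 2 * pi) = u \<eta> \<phi>"
    and p0: "has_continuous_partials {0..<L} u ux uy"
    and px: "has_continuous_partials {0<..<L} ux uxx uxy"
    and py: "has_continuous_partials {0<..<L} uy uyx uyy"
    and harm: "\<forall>\<eta>\<in>{0<..<L}. \<forall>\<phi>. uxx \<eta> \<phi> + uyy \<eta> \<phi> = 0"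
    and bd: "\<forall>\<phi>. u L \<phi> = 0" and ev: "\<forall>\<phi>. u 0 (- \<phi>) = u 0 \<phi>" and od: "\<forall>\<phi>. ux 0 (- \<phi>) = - ux 0 \<phi>"
    using u unfolding classical_solution_def by blast
  have dx: "((\<lambda>s. u s \<phi>) has_real_derivative ux \<eta> \<phi>) (at \<eta> within {0..<L})"
    and dy: "((\<lambda>t. u \<eta> t) has_real_derivative uy \<eta> \<phi>) (at \<phi>)" if "\<eta> \<in> {0..<L}" for \<eta> \<phi>
    using p0 that unfolding has_continuous_partials_def by blast+
  have dxx: "((\<lambda>s. ux s \<phi>) has_real_derivative uxx \<eta> \<phi>) (at \<eta> within {0<..<L})"
    and dyy: "((\<lambda>t. uy \<eta> t) has_real_derivative uyy \<eta> \<phi>) (at \<phi>)" if "\<eta> \<in> {0<..<L}" for \<eta> \<phi>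
    using px py that unfolding has_continuous_partials_def by blast+
  have cx: "continuous_on ({0..<L} \<times> UNIV) (\<lambda>(\<eta>, \<phi>). ux \<eta> \<phi>)"
    and cxx: "continuous_on ({0<..<L} \<times> UNIV) (\<lambda>(\<eta>, \<phi>). uxx \<eta> \<phi>)"
    using p0 px unfolding has_continuous_partials_def by blast+
  let ?I = "cbox 0 (2 * pi) :: real set"
  define E where "E = (\<lambda>\<eta>. integral ?I (\<lambda>\<phi>. (u \<eta> \<phi>)\<^sup>2))"
  define E1 where "E1 = (\<lambda>\<eta>. integral ?I (\<lambda>\<phi>. 2 * u \<eta> \<phi> * ux \<eta> \<phi>))"
  define e2 where "e2 = (\<lambda>\<eta> \<phi>. 2 * (ux \<eta> \<phi>)\<^sup>2 + 2 * u \<eta> \<phi> * uxx \<eta> \<phi>)"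
  have slice: "continuous_on ?I (f \<eta>)" if "continuous_on (A \<times> UNIV) (\<lambda>(\<eta>, \<phi>). f \<eta> \<phi>)" "\<eta> \<in> A"
    for f :: "real \<Rightarrow> real \<Rightarrow> real" and A \<eta>
  proof -
    have "continuous_on ?I (\<lambda>t. (\<lambda>(\<eta>, \<phi>). f \<eta> \<phi>) (\<eta>, t))"
      by (rule continuous_on_compose2[OF that(1)]) (use that in \<open>auto intro!: continuous_intros\<close>)
    then show ?thesis by simp
  qed
  have pairc: "continuous_on (B \<times> ?I) (\<lambda>(\<eta>, \<phi>). f \<eta> \<phi>)"
    if "continuous_on (A \<times> UNIV) (\<lambda>(\<eta>, \<phi>). f \<eta> \<phi>)" "B \<subseteq> A" for f :: "real \<Rightarrow> real \<Rightarrow> real" and A B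
    by (rule continuous_on_subset[OF that(1)]) (use that in auto)
  have less_eq1: "{0..<L} \<subseteq> {0..L}" and less_eq2: "{0<..<L} \<subseteq> {0..L}"
    and less_eq3: "{0<..<L} \<subseteq> {0..<L}" by auto
  have cu: "continuous_on ({0..L} \<times> ?I) (\<lambda>(\<eta>, \<phi>). (u \<eta> \<phi>)\<^sup>2)"
    using pairc[OF cont order_refl] unfolding split_beta' by (intro continuous_intros)
  have c1: "continuous_on ({0..<L} \<times> ?I) (\<lambda>(\<eta>, \<phi>). 2 * u \<eta> \<phi> * ux \<eta> \<phi>)"
    using pairc[OF cont less_eq1] pairc[OF cx order_refl]
    unfolding split_beta' by (intro continuous_intros)
  have c2: "continuous_on ({0<..<L} \<times> ?I) (\<lambda>(\<eta>, \<phi>). e2 \<eta> \<phi>)"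
    using pairc[OF cont less_eq2] pairc[OF cx less_eq3] pairc[OF cxx order_refl]
    unfolding e2_def split_beta' by (intro continuous_intros)
  have E_cont: "continuous_on {0..L} E"
    unfolding E_def by (rule integral_continuous_on_param[OF cu])
  have E1_cont: "continuous_on {0..<L} E1"
    unfolding E1_def by (rule integral_continuous_on_param[OF c1])
  have E_deriv: "(E has_real_derivative E1 \<eta>) (at \<eta> within {0..<L})" if "\<eta> \<in> {0..<L}" for \<eta>
    unfolding E_def E1_def
  proof (rule leibniz_rule_field_derivative[OF _ _ c1 that])
    fix x t assume "x \<in> {0..<L}"
    then show "((\<lambda>x. (u x t)\<^sup>2) has_real_derivative 2 * u x t * ux x t) (at x within {0..<L})"
      by (auto intro!: derivative_eq_intros dx)
    show "(\<lambda>t. (u x t)\<^sup>2) integrable_on ?I"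
      by (intro integrable_continuous continuous_intros slice[OF cont]) (use \<open>x \<in> {0..<L}\<close> in auto)
  qed auto
  have E1_deriv: "(E1 has_real_derivative integral ?I (e2 \<eta>)) (at \<eta> within {0<..<L})"
    if "\<eta> \<in> {0<..<L}" for \<eta>
    unfolding E1_def
  proof (rule leibniz_rule_field_derivative[OF _ _ c2 that])
    fix x t assume x: "x \<in> {0<..<L}"
    have "((\<lambda>s. u s t) has_real_derivative ux x t) (at x within {0<..<L})"
      by (rule DERIV_subset[OF dx]) (use x in auto)
    then show "((\<lambda>x. 2 * u x t * ux x t) has_real_derivative e2 x t) (at x within {0<..<L})"
      using x by (auto intro!: derivative_eq_intros dxx simp: e2_def power2_eq_square algebra_simps)
    show "(\<lambda>t. 2 * u x t * ux x t) integrable_on ?I"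
      by (intro integrable_continuous continuous_intros slice[OF cont] slice[OF cx]) (use x in auto)
  qed auto
  \<comment> \<open>Integration by parts has no boundary terms only if \<open>uy\<close> is periodic as well, and \<open>E1 0 = 0\<close> needs the same for \<open>ux\<close>. Derivatives of a periodic function are periodic since they are unique.\<close>
  have uy_per: "uy \<eta> (\<phi> + 2 * pi) = uy \<eta> \<phi>" if "\<eta> \<in> {0..<L}" for \<eta> \<phi>
  proof -
    have "((\<lambda>t. u \<eta> (t + 2 * pi)) has_real_derivative uy \<eta> (\<phi> + 2 * pi)) (at \<phi>)"
      using dy[OF that, of "\<phi> + 2 * pi"] DERIV_shift by blast
    moreover have "(\<lambda>t. u \<eta> (t + 2 * pi)) = u \<eta>" using per that by auto
    ultimately show ?thesis using dy[OF that, of \<phi>] DERIV_unique by fastforce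
  qed
  have ux_per: "ux 0 (\<phi> + 2 * pi) = ux 0 \<phi>" for \<phi>
  proof -
    have 0: "0 \<in> {0..<L}" using L by simp
    have "((\<lambda>s. u s \<phi>) has_real_derivative ux 0 (\<phi> + 2 * pi)) (at 0 within {0..<L})"
      by (rule has_field_derivative_transform_within[OF dx[OF 0, of "\<phi> + 2 * pi"] zero_less_one 0])
         (use per in auto)
    moreover have "at 0 within {0..<L} \<noteq> bot"
      using L by (auto simp: trivial_limit_within intro!: islimpt_closure_open[where s = "{0<..<L}"])
    ultimately show ?thesis using has_field_derivative_unique[OF _ dx[OF 0, of \<phi>]] by blast
  qed
  have conv: "integral ?I (e2 \<eta>) \<ge> 0" if \<eta>: "\<eta> \<in> {0<..<L}" for \<eta>
  proof -
    have \<eta>': "\<eta> \<in> {0..<L}" using \<eta> by auto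
    \<comment> \<open>The integrand is the \<open>\<phi>\<close>-derivative of \<open>u uy\<close>, so it integrates to \<open>0\<close> over a period.\<close>
    have "((\<lambda>\<phi>. (uy \<eta> \<phi>)\<^sup>2 + u \<eta> \<phi> * uyy \<eta> \<phi>) has_integral
        u \<eta> (2 * pi) * uy \<eta> (2 * pi) - u \<eta> 0 * uy \<eta> 0) {0..2 * pi}"
    proof (rule fundamental_theorem_of_calculus)
      fix x :: real
      have "((\<lambda>\<phi>. u \<eta> \<phi> * uy \<eta> \<phi>) has_real_derivative (uy \<eta> x)\<^sup>2 + u \<eta> x * uyy \<eta> x) (at x)"
        by (rule DERIV_cong[OF DERIV_mult[OF dy[OF \<eta>'] dyy[OF \<eta>]]]) (simp add: power2_eq_square algebra_simps)
      then show "((\<lambda>\<phi>. u \<eta> \<phi> * uy \<eta> \<phi>) has_vector_derivative (uy \<eta> x)\<^sup>2 + u \<eta> x * uyy \<eta> x)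
          (at x within {0..2 * pi})"
        unfolding has_real_derivative_iff_has_vector_derivative
        by (rule has_vector_derivative_at_within)
    qed simp
    moreover have "u \<eta> (2 * pi) = u \<eta> 0" "uy \<eta> (2 * pi) = uy \<eta> 0"
      using per[rule_format, of \<eta> 0] uy_per[OF \<eta>', of 0] \<eta> by auto
    ultimately have z: "((\<lambda>\<phi>. (uy \<eta> \<phi>)\<^sup>2 + u \<eta> \<phi> * uyy \<eta> \<phi>) has_integral 0) ?I"
      by (simp add: cbox_interval)
    have "continuous_on ?I (e2 \<eta>)"
      unfolding e2_def by (intro continuous_intros slice[OF cont] slice[OF cx] slice[OF cxx]) (use \<eta> in auto)
    then have i2: "(e2 \<eta> has_integral integral ?I (e2 \<eta>)) ?I"
      by (intro integrable_integral integrable_continuous)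
    \<comment> \<open>Adding this zero to \<open>E''\<close> turns its integrand into a sum of squares.\<close>
    have "((\<lambda>\<phi>. e2 \<eta> \<phi> + 2 * ((uy \<eta> \<phi>)\<^sup>2 + u \<eta> \<phi> * uyy \<eta> \<phi>)) has_integral
        integral ?I (e2 \<eta>) + 2 * 0) ?I"
      by (intro has_integral_add i2 has_integral_mult_right z)
    then have i3: "((\<lambda>\<phi>. e2 \<eta> \<phi> + 2 * ((uy \<eta> \<phi>)\<^sup>2 + u \<eta> \<phi> * uyy \<eta> \<phi>)) has_integral
        integral ?I (e2 \<eta>)) ?I" by simp
    have "e2 \<eta> \<phi> + 2 * ((uy \<eta> \<phi>)\<^sup>2 + u \<eta> \<phi> * uyy \<eta> \<phi>) = 2 * (ux \<eta> \<phi>)\<^sup>2 + 2 * (uy \<eta> \<phi>)\<^sup>2" for \<phi>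
    proof -
      have "uxx \<eta> \<phi> + uyy \<eta> \<phi> = 0" using harm \<eta> by blast
      then have "uxx \<eta> \<phi> = - uyy \<eta> \<phi>" by linarith
      then show ?thesis by (simp add: e2_def)
    qed
    then have "0 \<le> e2 \<eta> \<phi> + 2 * ((uy \<eta> \<phi>)\<^sup>2 + u \<eta> \<phi> * uyy \<eta> \<phi>)" for \<phi>
      by (simp only:) simp
    then show ?thesis by (rule has_integral_nonneg[OF i3])
  qed
  have E1_0: "E1 0 = 0"
    unfolding E1_def cbox_interval
    by (rule integral_odd_periodic) (use ev od ux_per per L in auto)
  have E1_nonneg: "E1 \<eta> \<ge> 0" if "\<eta> \<in> {0..<L}" for \<eta>
  proof -
    have "E1 0 \<le> E1 \<eta>"
    proof (rule DERIV_nonneg_imp_increasing_open[of 0 \<eta> E1])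
      fix x assume "0 < x" "x < \<eta>"
      then have x: "x \<in> {0<..<L}" using that by auto
      have "(E1 has_real_derivative integral ?I (e2 x)) (at x)"
        using E1_deriv[OF x] at_within_open[OF x] by simp
      with conv[OF x] show "\<exists>y. DERIV E1 x :> y \<and> 0 \<le> y" by blast
    qed (use that in \<open>auto intro: continuous_on_subset[OF E1_cont]\<close>)
    then show ?thesis by (simp add: E1_0)
  qed
  have "E \<eta>0 \<le> E L"
  proof (rule DERIV_nonneg_imp_increasing_open[of \<eta>0 L E])
    fix x assume "\<eta>0 < x" "x < L"
    then have x: "x \<in> {0<..<L}" using \<eta>0 by auto
    have "(E has_real_derivative E1 x) (at x within {0<..<L})"
      by (rule DERIV_subset[OF E_deriv]) (use x in auto)
    then have "(E has_real_derivative E1 x) (at x)"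
      using at_within_open[OF x] by simp
    with E1_nonneg[of x] x show "\<exists>y. DERIV E x :> y \<and> 0 \<le> y" by auto
  qed (use \<eta>0 in \<open>auto intro: continuous_on_subset[OF E_cont]\<close>)
  also have "E L = 0" by (simp add: E_def bd)
  finally have "E \<eta>0 \<le> 0" .
  moreover have "E \<eta>0 \<ge> 0" unfolding E_def
    by (intro integral_nonneg integrable_continuous continuous_intros slice[OF cont \<eta>0]) auto
  ultimately have "integral {0..2 * pi} (\<lambda>\<phi>. (u \<eta>0 \<phi>)\<^sup>2) = 0" by (simp add: E_def cbox_interval)
  moreover have "continuous_on {0..2 * pi} (\<lambda>\<phi>. (u \<eta>0 \<phi>)\<^sup>2)"
    using slice[OF cont \<eta>0] by (auto simp: cbox_interval intro: continuous_intros)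
  ultimately have "\<forall>t\<in>{0..2 * pi}. (u \<eta>0 t)\<^sup>2 = 0"
    using integral_eq_0_iff[of 0 "2 * pi" "\<lambda>\<phi>. (u \<eta>0 \<phi>)\<^sup>2"] by simp
  moreover obtain t where "t \<in> {0..2 * pi}" "u \<eta>0 \<phi> = u \<eta>0 t"
    by (rule periodic_representative[of "u \<eta>0" \<phi>]) (use per \<eta>0 in auto)
  ultimately show ?thesis by simp
qed

section \<open>Density of trigonometric polynomials\<close>

inductive_set trig_polys :: "(real \<Rightarrow> real) set" where
  cos: "(\<lambda>x. cos (real k * x)) \<in> trig_polys"
| sin: "(\<lambda>x. sin (real k * x)) \<in> trig_polys"
| add: "f \<in> trig_polys \<Longrightarrow> g \<in> trig_polys \<Longrightarrow> (\<lambda>x. f x + g x) \<in> trig_polys"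
| scale: "f \<in> trig_polys \<Longrightarrow> (\<lambda>x. c * f x) \<in> trig_polys"

lemma trig_polys_cos_int: "(\<lambda>x. cos (of_int m * x)) \<in> trig_polys"
proof -
  have "(\<lambda>x. cos (of_int m * x)) = (\<lambda>x. cos (real (nat \<bar>m\<bar>) * x))"
  proof (cases "m \<ge> 0")
    case False
    have "cos (of_int m * x) = cos (- (of_int m * x))" for x :: real by (rule cos_minus[symmetric])
    with False show ?thesis by simp
  qed simp
  then show ?thesis by (simp only: trig_polys.cos)
qed

lemma trig_polys_sin_int: "(\<lambda>x. sin (of_int m * x)) \<in> trig_polys"
proof -
  have "(\<lambda>x. sin (of_int m * x)) = (\<lambda>x. of_int (sgn m) * sin (real (nat \<bar>m\<bar>) * x))"
    by (cases m "0 :: int" rule: linorder_cases) auto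
  then show ?thesis by (simp only: trig_polys.scale trig_polys.sin)
qed

text \<open>
  By the product-to-sum formulas. The frequency \<open>k - m\<close> may be negative, hence the detour through
  integer frequencies. Closure under products is what makes polynomials in \<open>cos\<close> and \<open>sin\<close>
  trigonometric polynomials.
\<close>

lemma trig_polys_mult:
  assumes "f \<in> trig_polys" "g \<in> trig_polys"
  shows "(\<lambda>x. f x * g x) \<in> trig_polys"
proof -
  note half = trig_polys.scale[where c = "1 / 2"]
  have cc: "(\<lambda>x. cos (real k * x) * cos (real m * x)) \<in> trig_polys" for k m
    using half[OF trig_polys.add[OF trig_polys_cos_int[of "int k - int m"] trig_polys_cos_int[of "int k + int m"]]]
    by (simp add: cos_times_cos algebra_simps add_divide_distrib)
  have ss: "(\<lambda>x. sin (real k * x) * sin (real m * x)) \<in> trig_polys" for k m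
    using half[OF trig_polys.add[OF trig_polys_cos_int[of "int k - int m"]
          trig_polys.scale[OF trig_polys_cos_int[of "int k + int m"], of "-1"]]]
    by (simp add: sin_times_sin algebra_simps diff_divide_distrib)
  have sc: "(\<lambda>x. sin (real k * x) * cos (real m * x)) \<in> trig_polys" for k m
    using half[OF trig_polys.add[OF trig_polys_sin_int[of "int k + int m"] trig_polys_sin_int[of "int k - int m"]]]
    unfolding sin_times_cos by (simp add: algebra_simps add_divide_distrib)
  have cs: "(\<lambda>x. cos (real k * x) * sin (real m * x)) \<in> trig_polys" for k m
    using sc[of m k] by (simp add: mult.commute)
  have base: "(\<lambda>x. f x * g x) \<in> trig_polys"
    if "\<And>k. (\<lambda>x. f x * cos (real k * x)) \<in> trig_polys"
       "\<And>k. (\<lambda>x. f x * sin (real k * x)) \<in> trig_polys" "g \<in> trig_polys" for f g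
    using that(3)
  proof induction
    case (add g1 g2)
    then show ?case using trig_polys.add[OF add.IH] by (simp add: distrib_left)
  next
    case (scale g c)
    then show ?case using trig_polys.scale[OF scale.IH, of c] by (simp add: mult.left_commute)
  qed (use that in auto)
  show ?thesis
    using assms(1)
  proof induction
    case (add f1 f2)
    then show ?case using trig_polys.add[OF add.IH] by (simp add: distrib_right)
  next
    case (scale f c)
    then show ?case using trig_polys.scale[OF scale.IH, of c] by (simp add: mult.assoc)
  qed (use base[OF cc cs] base[OF sc ss] assms(2) in auto)
qed

lemma trig_polys_const: "(\<lambda>x. c) \<in> trig_polys"
  using trig_polys.scale[OF trig_polys.cos[of 0], of c] by simp

lemma trig_polys_continuous: "f \<in> trig_polys \<Longrightarrow> continuous_on A f"
  by (induction rule: trig_polys.induct) (auto intro!: continuous_intros)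

lemma polynomial_on_circle:
  fixes p :: "complex \<Rightarrow> real"
  assumes "real_polynomial_function p"
  shows "(\<lambda>x. p (cis x)) \<in> trig_polys"
  using assms
proof induction
  case (linear f)
  interpret bounded_linear f by fact
  have "f (cis x) = f 1 * cos x + f \<i> * sin x" for x
  proof -
    have "cis x = cos x *\<^sub>R 1 + sin x *\<^sub>R \<i>" by (simp add: complex_eq_iff)
    then show ?thesis by (simp only: add scaleR) simp
  qed
  moreover have "(\<lambda>x. f 1 * cos x + f \<i> * sin x) \<in> trig_polys"
    using trig_polys.add[OF trig_polys.scale[OF trig_polys.cos[of 1], of "f 1"] trig_polys.scale[OF trig_polys.sin[of 1], of "f \<i>"]]
    by simp
  ultimately show ?case by simp
qed (auto intro: trig_polys_const trig_polys.add trig_polys_mult)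

text \<open>
  The circle is a quotient of the compact interval \<open>{0..2 * pi}\<close>: the preimage of a closed set under
  the induced function is the image under \<open>cis\<close> of a compact set. This avoids a case distinction
  at the branch cut of the argument.
\<close>

lemma periodic_continuous_on_circle:
  fixes h :: "real \<Rightarrow> real"
  assumes h: "continuous_on UNIV h" and per: "\<And>x. h (x + 2 * pi) = h x"
  obtains H where "continuous_on (sphere 0 1) H" "\<And>x. H (cis x) = h x"
proof
  let ?H = "\<lambda>z. h (Arg2pi z)"
  show eq: "?H (cis x) = h x" for x
  proof -
    interpret h: periodic_fun_simple h "2 * pi" by standard (rule per)
    have "cis (Arg2pi (cis x)) = cis x"
      using Arg2pi_eq[of "cis x"] by (simp add: cis_conv_exp)
    then have "sin (Arg2pi (cis x)) = sin x \<and> cos (Arg2pi (cis x)) = cos x"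
      unfolding complex_eq_iff cis.sel by (rule conj_commute[THEN iffD1])
    then obtain n where n: "Arg2pi (cis x) = x + 2 * pi * real_of_int n"
      unfolding sin_cos_eq_iff by (rule exE)
    show ?thesis unfolding n using h.plus_of_int[of x n] by (simp only: mult.commute)
  qed
  show "continuous_on (sphere 0 1) ?H"
    unfolding continuous_on_closed_vimage[OF closed_sphere]
  proof (intro allI impI)
    fix B :: "real set" assume B: "closed B"
    have "?H -` B \<inter> sphere 0 1 = cis ` ({0..2 * pi} \<inter> h -` B)"
    proof (intro equalityI subsetI)
      fix z assume z: "z \<in> ?H -` B \<inter> sphere 0 1"
      then have "cis (Arg2pi z) = z"
        using Arg2pi_eq[of z] by (simp add: cis_conv_exp)
      moreover have "Arg2pi z \<in> {0..2 * pi} \<inter> h -` B"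
        using Arg2pi_ge_0[of z] Arg2pi_lt_2pi[of z] z by simp
      ultimately show "z \<in> cis ` ({0..2 * pi} \<inter> h -` B)" by (rule image_eqI[OF sym])
    next
      fix z assume "z \<in> cis ` ({0..2 * pi} \<inter> h -` B)"
      then obtain x where "z = cis x" "h x \<in> B" by blast
      then show "z \<in> ?H -` B \<inter> sphere 0 1" by (simp add: eq)
    qed
    moreover have "compact (cis ` ({0..2 * pi} \<inter> h -` B))"
      by (intro compact_continuous_image continuous_on_cis continuous_on_id
           compact_Int_closed compact_Icc closed_vimage[OF B h])
    ultimately show "closed (?H -` B \<inter> sphere 0 1)" by (simp add: compact_imp_closed)
  qed
qed

text \<open>
  The Stone--Weierstrass theorem on the unit circle.
\<close>

lemma trig_polys_dense:
  fixes h :: "real \<Rightarrow> real"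
  assumes h: "continuous_on UNIV h" and per: "\<And>x. h (x + 2 * pi) = h x" and e: "\<epsilon> > 0"
  obtains P where "P \<in> trig_polys" "\<And>x. \<bar>h x - P x\<bar> < \<epsilon>"
proof -
  obtain H where H: "continuous_on (sphere 0 1) H" "\<And>x. H (cis x) = h x"
    by (rule periodic_continuous_on_circle[OF h per]) (rule that)
  obtain p where p: "real_polynomial_function p" "\<And>z. z \<in> sphere 0 1 \<Longrightarrow> \<bar>H z - p z\<bar> < \<epsilon>"
    by (rule Stone_Weierstrass_real_polynomial_function[OF compact_sphere H(1) e]) (rule that)
  have "\<bar>h x - p (cis x)\<bar> < \<epsilon>" for x
    using p(2)[of "cis x"] H(2)[of x] by simp
  then show ?thesis
    by (rule that[OF polynomial_on_circle[OF p(1)]])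
qed

section \<open>Transforms of sines and cosines\<close>

lemma integral_cos_int:
  "integral {0..2 * pi} (\<lambda>\<tau>. cos (of_int m * \<tau>)) = (if m = 0 then 2 * pi else 0)"
proof (cases "m = 0")
  case False
  have "((\<lambda>\<tau>. cos (of_int m * \<tau>)) has_integral
      sin (of_int m * (2 * pi)) / of_int m - sin (of_int m * 0) / of_int m) {0..2 * pi}"
    by (rule fundamental_theorem_of_calculus)
       (use False in \<open>auto intro!: derivative_eq_intros
          simp flip: has_real_derivative_iff_has_vector_derivative\<close>)
  moreover have "sin (of_int m * (2 * pi)) = 0"
    using sin_integer_2pi[of "of_int m"] by (simp add: mult.commute)
  ultimately show ?thesis using False by (simp add: integral_unique)
qed simp

lemma fourier_same_parity:
  "fourier_cos (\<lambda>x. cos (real m * x)) k = (if k = m then if m = 0 then 2 * pi else pi else 0)"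
  "fourier_sin (\<lambda>x. sin (real m * x)) k = (if k = m \<and> m \<noteq> 0 then pi else 0)"
proof -
  let ?c = "\<lambda>j \<tau>. cos (of_int j * \<tau>)"
  have int: "?c j integrable_on {0..2 * pi}" for j :: int
    by (intro integrable_continuous_interval continuous_intros)
  have "fourier_cos (\<lambda>x. cos (real m * x)) k
      = integral {0..2 * pi} (\<lambda>\<tau>. 1 / 2 * (?c (int m - int k) \<tau> + ?c (int m + int k) \<tau>))"
    unfolding fourier_cos_def cos_times_cos
    by (intro arg_cong[where f = "integral _"] ext) (simp add: algebra_simps add_divide_distrib)
  also have "\<dots> = 1 / 2 * (integral {0..2 * pi} (?c (int m - int k)) + integral {0..2 * pi} (?c (int m + int k)))"
    by (simp only: integral_mult_right integral_add[OF int int])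
  also have "\<dots> = (if k = m then if m = 0 then 2 * pi else pi else 0)"
    unfolding integral_cos_int by auto
  finally show "fourier_cos (\<lambda>x. cos (real m * x)) k = (if k = m then if m = 0 then 2 * pi else pi else 0)" .
  have "fourier_sin (\<lambda>x. sin (real m * x)) k
      = integral {0..2 * pi} (\<lambda>\<tau>. 1 / 2 * (?c (int m - int k) \<tau> - ?c (int m + int k) \<tau>))"
    unfolding fourier_sin_def sin_times_sin
    by (intro arg_cong[where f = "integral _"] ext) (simp add: algebra_simps diff_divide_distrib)
  also have "\<dots> = 1 / 2 * (integral {0..2 * pi} (?c (int m - int k)) - integral {0..2 * pi} (?c (int m + int k)))"
    by (simp only: integral_mult_right integral_diff[OF int int])
  also have "\<dots> = (if k = m \<and> m \<noteq> 0 then pi else 0)"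
    unfolding integral_cos_int by auto
  finally show "fourier_sin (\<lambda>x. sin (real m * x)) k = (if k = m \<and> m \<noteq> 0 then pi else 0)" .
qed

lemma trig_shift_period:
  "cos (real m * (x + 2 * pi)) = cos (real m * x)" "sin (real m * (x + 2 * pi)) = sin (real m * x)"
proof -
  have e: "real m * (x + 2 * pi) = real m * x + of_int (int m) * (2 * pi)"
    by (simp add: algebra_simps)
  show "cos (real m * (x + 2 * pi)) = cos (real m * x)" "sin (real m * (x + 2 * pi)) = sin (real m * x)"
    unfolding e
    using cos.plus_of_int[of "real m * x" "int m"] sin.plus_of_int[of "real m * x" "int m"] by simp_all
qed

lemma fourier_opposite_parity:
  "fourier_sin (\<lambda>x. cos (real m * x)) k = 0"
  "fourier_cos (\<lambda>x. sin (real m * x)) k = 0"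
proof -
  show "fourier_sin (\<lambda>x. cos (real m * x)) k = 0"
    unfolding fourier_sin_def
    by (rule integral_odd_periodic) (simp_all only: trig_shift_period, simp)
  show "fourier_cos (\<lambda>x. sin (real m * x)) k = 0"
    unfolding fourier_cos_def
    by (rule integral_odd_periodic) (simp_all only: trig_shift_period, simp)
qed

lemma trig_polys_periodic: "P \<in> trig_polys \<Longrightarrow> P (x + 2 * pi) = P x"
  by (induction rule: trig_polys.induct) (simp_all only: trig_shift_period)

text \<open>
  By orthogonality a single term of the series survives. For \<open>m = 0\<close> no term survives; the value \<open>1\<close>
  then comes from the constant term of the kernel.
\<close>

lemma kernel_integral_cos:
  assumes "L > 0" "0 \<le> \<eta>" "\<eta> < L"
  shows "kernel_integral L (\<lambda>x. cos (real m * x)) \<eta> \<phi>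
    = cosh (real m * \<eta>) / cosh (real m * L) * cos (real m * \<phi>)"
proof -
  let ?f = "\<lambda>x. cos (real m * x)"
  let ?v = "cosh (real m * \<eta>) / cosh (real m * L) * cos (real m * \<phi>)"
  have "(\<lambda>n. if Suc n = m then ?v else 0)
      sums (kernel_integral L ?f \<eta> \<phi> - fourier_cos ?f 0 / (2 * pi))"
    using kernel_integral_sums[OF assms, of ?f \<phi>]
    by (rule back_subst[of "\<lambda>f. f sums _"])
       (auto simp: fourier_same_parity fourier_opposite_parity fun_eq_iff intro!: continuous_intros)
  moreover have "(\<lambda>n. if Suc n = m then ?v else 0) sums (?v - fourier_cos ?f 0 / (2 * pi))"
  proof (cases m)
    case 0
    then show ?thesis by (simp only: fourier_same_parity) simp
  next
    case (Suc k)
    show ?thesis using sums_single[of k "\<lambda>_. ?v"]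
      unfolding Suc by (simp add: fourier_same_parity eq_commute del: of_nat_Suc)
  qed
  ultimately show ?thesis using sums_unique2 by fastforce
qed

text \<open>
  For \<open>m = 0\<close> both sides vanish, the right one by the convention \<open>0 / 0 = 0\<close>.
\<close>

lemma kernel_integral_sin:
  assumes "L > 0" "0 \<le> \<eta>" "\<eta> < L"
  shows "kernel_integral L (\<lambda>x. sin (real m * x)) \<eta> \<phi>
    = sinh (real m * \<eta>) / sinh (real m * L) * sin (real m * \<phi>)"
proof -
  let ?f = "\<lambda>x. sin (real m * x)"
  let ?v = "sinh (real m * \<eta>) / sinh (real m * L) * sin (real m * \<phi>)"
  have "(\<lambda>n. if Suc n = m then ?v else 0)
      sums (kernel_integral L ?f \<eta> \<phi> - fourier_cos ?f 0 / (2 * pi))"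
    using kernel_integral_sums[OF assms, of ?f \<phi>]
    by (rule back_subst[of "\<lambda>f. f sums _"])
       (auto simp: fourier_same_parity fourier_opposite_parity fun_eq_iff intro!: continuous_intros)
  moreover have "(\<lambda>n. if Suc n = m then ?v else 0) sums (?v - fourier_cos ?f 0 / (2 * pi))"
  proof (cases m)
    case 0
    then show ?thesis by (simp only: fourier_opposite_parity) simp
  next
    case (Suc k)
    show ?thesis using sums_single[of k "\<lambda>_. ?v"]
      unfolding Suc by (simp add: fourier_opposite_parity eq_commute del: of_nat_Suc)
  qed
  ultimately show ?thesis using sums_unique2 by fastforce
qed

section \<open>Maximum principle and boundary values\<close>

text \<open>
  With \<open>w = exp z\<close> the left side is \<open>cosh (k z)\<close>. Its real and imaginary parts are the building blocks
  of the kernel, so the separated solutions in the strip are the real parts of multiples of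
  \<open>(w ^ k + w powi (- k)) / 2\<close>.
\<close>

lemma exp_power_mean:
  "(exp (Complex x y) ^ k + inverse (exp (Complex x y)) ^ k) / 2
    = Complex (cosh (real k * x) * cos (real k * y)) (sinh (real k * x) * sin (real k * y))"
proof -
  have "exp (Complex x y) ^ k = exp (Complex (real k * x) (real k * y))"
    by (simp add: exp_of_nat_mult[symmetric] complex_eq_iff Re_exp Im_exp)
  moreover have "inverse (exp (Complex x y)) ^ k = exp (Complex (- (real k * x)) (- (real k * y)))"
    by (simp add: exp_of_nat_mult[symmetric] exp_minus[symmetric] complex_eq_iff Re_exp Im_exp)
  ultimately show ?thesis
    by (simp add: complex_eq_iff Re_exp Im_exp cosh_def sinh_def field_simps)
qed

text \<open>
  For a trigonometric polynomial the transform is a finite sum. It is therefore the real part of a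
  function of \<open>w = exp (\<eta> + \<i> \<phi>)\<close> that is holomorphic even across the boundary of the annulus,
  and its values on both boundary circles can be read off.
\<close>

lemma trig_poly_extension:
  assumes L: "L > 0" and P: "P \<in> trig_polys"
  shows "\<exists>F. F holomorphic_on - {0} \<and>
    (\<forall>\<eta>\<in>{0..<L}. \<forall>\<phi>. kernel_integral L P \<eta> \<phi> = Re (F (exp (Complex \<eta> \<phi>)))) \<and>
    (\<forall>\<phi>. Re (F (exp (Complex L \<phi>))) = P \<phi> \<and> Re (F (exp (Complex (- L) \<phi>))) = P (- \<phi>))"
  using P
proof induction
  case (cos k)
  let ?F = "\<lambda>w. of_real (1 / cosh (real k * L)) * ((w ^ k + inverse w ^ k) / 2) :: complex"
  show ?case
  proof (intro exI[of _ ?F] conjI)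
    show "?F holomorphic_on - {0}" by (intro holomorphic_intros) auto
  qed (use L in \<open>auto simp: exp_power_mean kernel_integral_cos simp del: of_real_divide\<close>)
next
  case (sin k)
  let ?F = "\<lambda>w. - \<i> * of_real (1 / sinh (real k * L)) * ((w ^ k + inverse w ^ k) / 2) :: complex"
  show ?case
  proof (intro exI[of _ ?F] conjI)
    show "?F holomorphic_on - {0}" by (intro holomorphic_intros) auto
  qed (use L in \<open>auto simp: exp_power_mean kernel_integral_sin simp del: of_real_divide\<close>)
next
  case (add f g)
  from add.IH obtain F where F: "F holomorphic_on - {0}"
    "\<forall>\<eta>\<in>{0..<L}. \<forall>\<phi>. kernel_integral L f \<eta> \<phi> = Re (F (exp (Complex \<eta> \<phi>)))"
    "\<forall>\<phi>. Re (F (exp (Complex L \<phi>))) = f \<phi> \<and> Re (F (exp (Complex (- L) \<phi>))) = f (- \<phi>)" by blast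
  from add.IH obtain G where G: "G holomorphic_on - {0}"
    "\<forall>\<eta>\<in>{0..<L}. \<forall>\<phi>. kernel_integral L g \<eta> \<phi> = Re (G (exp (Complex \<eta> \<phi>)))"
    "\<forall>\<phi>. Re (G (exp (Complex L \<phi>))) = g \<phi> \<and> Re (G (exp (Complex (- L) \<phi>))) = g (- \<phi>)" by blast
  show ?case
  proof (intro exI[of _ "\<lambda>w. F w + G w"] conjI ballI allI)
    show "(\<lambda>w. F w + G w) holomorphic_on - {0}" using F G by (intro holomorphic_intros)
    fix \<eta> \<phi> assume "\<eta> \<in> {0..<L}"
    then show "kernel_integral L (\<lambda>x. f x + g x) \<eta> \<phi>
        = Re (F (exp (Complex \<eta> \<phi>)) + G (exp (Complex \<eta> \<phi>)))"
      using F G by (simp add: kernel_integral_add L trig_polys_continuous add.hyps)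
  qed (use F G in auto)
next
  case (scale f c)
  from scale.IH obtain F where F: "F holomorphic_on - {0}"
    "\<forall>\<eta>\<in>{0..<L}. \<forall>\<phi>. kernel_integral L f \<eta> \<phi> = Re (F (exp (Complex \<eta> \<phi>)))"
    "\<forall>\<phi>. Re (F (exp (Complex L \<phi>))) = f \<phi> \<and> Re (F (exp (Complex (- L) \<phi>))) = f (- \<phi>)" by blast
  show ?case
    by (rule exI[of _ "\<lambda>w. of_real c * F w"])
       (use F in \<open>auto simp: kernel_integral_scale intro!: holomorphic_intros\<close>)
qed

text \<open>
  In the variable \<open>w\<close> the strip becomes a bounded set, to which the maximum principle for real
  parts applies; its frontier consists of the two circles \<open>\<bar>w\<bar> = exp (\<plusminus> L)\<close>.
\<close>

lemma annulus_maximum_principle: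
  fixes M :: real
  assumes L: "L > 0" and F: "F holomorphic_on - {0}"
    and outer: "\<And>\<phi>. Re (F (exp (Complex L \<phi>))) \<le> M"
    and inner: "\<And>\<phi>. Re (F (exp (Complex (- L) \<phi>))) \<le> M"
    and \<eta>: "\<bar>\<eta>\<bar> \<le> L"
  shows "Re (F (exp (Complex \<eta> \<phi>))) \<le> M"
proof -
  define S where "S = {z :: complex. exp (- L) \<le> norm z \<and> norm z \<le> exp L}"
  have clS: "closed S"
    unfolding S_def by (intro closed_Collect_conj closed_Collect_le continuous_intros)
  have S0: "S \<subseteq> - {0}" unfolding S_def by (auto simp: not_le)
  have op: "open {z :: complex. exp (- L) < norm z \<and> norm z < exp L}"
    by (intro open_Collect_conj open_Collect_less continuous_intros)
  show ?thesis
  proof (rule maximum_real_frontier[of F S])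
    show "F holomorphic_on interior S"
      using holomorphic_on_subset[OF F] S0 interior_subset by blast
    show "continuous_on (closure S) F"
      using continuous_on_subset[OF holomorphic_on_imp_continuous_on[OF F]] S0 clS by simp
    show "bounded S"
      unfolding S_def by (rule boundedI[of _ "exp L"]) auto
    show "exp (Complex \<eta> \<phi>) \<in> S"
      using \<eta> by (auto simp: S_def)
    fix z assume z: "z \<in> frontier S"
    then have zS: "z \<in> S" using clS frontier_subset_closed by blast
    have "\<not> (exp (- L) < norm z \<and> norm z < exp L)"
    proof
      assume "exp (- L) < norm z \<and> norm z < exp L"
      then have "z \<in> interior S"
        by (intro interiorI[OF op]) (auto simp: S_def)
      with z show False by (simp add: frontier_def)
    qed
    then have "norm z = exp L \<or> norm z = exp (- L)"
      using zS by (auto simp: S_def)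
    moreover have "z = exp (Complex (ln (norm z)) (Arg z))"
    proof -
      have "z \<noteq> 0" using zS S0 by auto
      moreover have "Complex (ln (norm z)) (Arg z) = Ln z"
        using \<open>z \<noteq> 0\<close> by (simp add: complex_eq_iff Arg_eq_Im_Ln)
      ultimately show ?thesis by simp
    qed
    ultimately show "Re (F z) \<le> M"
      using outer[of "Arg z"] inner[of "Arg z"] by (metis ln_exp)
  qed
qed

lemma trig_poly_kernel_bound:
  assumes L: "L > 0" "0 \<le> \<eta>" "\<eta> < L" and P: "P \<in> trig_polys" and M: "\<And>x. \<bar>P x\<bar> \<le> M"
  shows "\<bar>kernel_integral L P \<eta> \<phi>\<bar> \<le> M"
proof -
  obtain F where F: "F holomorphic_on - {0}"
    "\<forall>\<eta>\<in>{0..<L}. \<forall>\<phi>. kernel_integral L P \<eta> \<phi> = Re (F (exp (Complex \<eta> \<phi>)))"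
    "\<forall>\<phi>. Re (F (exp (Complex L \<phi>))) = P \<phi> \<and> Re (F (exp (Complex (- L) \<phi>))) = P (- \<phi>)"
    using trig_poly_extension[OF L(1) P] by blast
  have eq: "kernel_integral L P \<eta> \<phi> = Re (F (exp (Complex \<eta> \<phi>)))"
    using F(2) L by simp
  have PM: "P x \<le> M" "- P x \<le> M" for x using M[of x] by linarith+
  have "Re (F (exp (Complex \<eta> \<phi>))) \<le> M"
    by (rule annulus_maximum_principle[OF L(1) F(1)]) (use L F(3) PM in simp_all)
  moreover have "Re (- F (exp (Complex \<eta> \<phi>))) \<le> M"
    by (rule annulus_maximum_principle[OF L(1) holomorphic_on_minus[OF F(1)]]) (use L F(3) PM in simp_all)
  ultimately
  show ?thesis unfolding eq by (simp add: abs_le_iff)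
qed

text \<open>
  Approximate \<open>h\<close> by \<open>P\<close> up to \<open>d\<close>. The transform of \<open>P\<close> is at most \<open>M + d\<close> and that of the error at most
  \<open>d * C\<close> by the crude bound; since the point of the strip is fixed, so is \<open>C\<close>, and \<open>d\<close> is arbitrary.
\<close>

lemma kernel_integral_bound:
  assumes L: "L > 0" "0 \<le> \<eta>" "\<eta> < L"
    and h: "continuous_on UNIV h" "\<And>x. h (x + 2 * pi) = h x" and M: "\<And>x. \<bar>h x\<bar> \<le> M"
  shows "\<bar>kernel_integral L h \<eta> \<phi>\<bar> \<le> M"
proof -
  obtain C where C: "C > 0"
    "\<And>f \<epsilon>. continuous_on UNIV f \<Longrightarrow> (\<And>x. \<bar>f x\<bar> \<le> \<epsilon>) \<Longrightarrow> \<bar>kernel_integral L f \<eta> \<phi>\<bar> \<le> \<epsilon> * C"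
    using kernel_integral_crude_bound[OF L, of \<phi>] by blast
  show ?thesis
  proof (rule field_le_epsilon)
    fix e :: real assume e: "e > 0"
    define d where "d = e / (1 + C)"
    have "d > 0" "d * (1 + C) = e" using e C(1) by (simp_all add: d_def)
    then have d: "d > 0" "d + d * C = e" by (simp_all add: distrib_left)
    obtain P where P: "P \<in> trig_polys" "\<And>x. \<bar>h x - P x\<bar> < d"
      by (rule trig_polys_dense[OF h d(1)]) (rule that)
    note cP = trig_polys_continuous[OF P(1)]
    have "kernel_integral L h \<eta> \<phi> = kernel_integral L (\<lambda>x. P x + (h x - P x)) \<eta> \<phi>" by simp
    also have "\<dots> = kernel_integral L P \<eta> \<phi> + kernel_integral L (\<lambda>x. h x - P x) \<eta> \<phi>"
      by (intro kernel_integral_add L continuous_intros h cP)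
    finally have "\<bar>kernel_integral L h \<eta> \<phi>\<bar>
        \<le> \<bar>kernel_integral L P \<eta> \<phi>\<bar> + \<bar>kernel_integral L (\<lambda>x. h x - P x) \<eta> \<phi>\<bar>" by linarith
    also have "\<bar>kernel_integral L P \<eta> \<phi>\<bar> \<le> M + d"
    proof (rule trig_poly_kernel_bound[OF L P(1)])
      show "\<bar>P x\<bar> \<le> M + d" for x using P(2)[of x] M[of x] by linarith
    qed
    also have "\<bar>kernel_integral L (\<lambda>x. h x - P x) \<eta> \<phi>\<bar> \<le> d * C"
      by (intro C(2) continuous_intros h cP less_imp_le[OF P(2)])
    finally show "\<bar>kernel_integral L h \<eta> \<phi>\<bar> \<le> M + e" using d(2) by linarith
  qed
qed

text \<open>
  This is where the boundary values at \<open>L\<close> are attained. By \<open>kernel_integral_bound\<close> the transforms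
  of trigonometric polynomials converge as fast in the strip as the polynomials converge to \<open>h\<close>,
  so the limit inherits continuity up to the boundary.
\<close>

lemma kernel_integral_extends_continuously:
  assumes L: "L > 0" and h: "continuous_on UNIV h" "\<And>x. h (x + 2 * pi) = h x"
  shows "continuous_on ({0..L} \<times> UNIV) (\<lambda>(\<eta>, \<phi>). if \<eta> < L then kernel_integral L h \<eta> \<phi> else h \<phi>)"
proof -
  have "\<exists>F P. F holomorphic_on - {0} \<and> P \<in> trig_polys \<and> (\<forall>x. \<bar>h x - P x\<bar> < 1 / real (Suc n)) \<and>
    (\<forall>\<eta>\<in>{0..<L}. \<forall>\<phi>. kernel_integral L P \<eta> \<phi> = Re (F (exp (Complex \<eta> \<phi>)))) \<and>
    (\<forall>\<phi>. Re (F (exp (Complex L \<phi>))) = P \<phi>)" for n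
  proof -
    obtain P where P: "P \<in> trig_polys" "\<And>x. \<bar>h x - P x\<bar> < 1 / real (Suc n)"
      by (rule trig_polys_dense[OF h, of "1 / real (Suc n)"]) (simp, rule that)
    then show ?thesis using trig_poly_extension[OF L P(1)] by blast
  qed
  then obtain F P where FP: "\<And>n. F n holomorphic_on - {0}" "\<And>n. P n \<in> trig_polys"
    "\<And>n x. \<bar>h x - P n x\<bar> < 1 / real (Suc n)"
    "\<And>n \<eta> \<phi>. \<eta> \<in> {0..<L} \<Longrightarrow> kernel_integral L (P n) \<eta> \<phi> = Re (F n (exp (Complex \<eta> \<phi>)))"
    "\<And>n \<phi>. Re (F n (exp (Complex L \<phi>))) = P n \<phi>"
    by metis
  show ?thesis
  proof (rule uniform_limit_theorem)
    show "\<forall>\<^sub>F n in sequentially. continuous_on ({0..L} \<times> UNIV)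
        (\<lambda>(\<eta>, \<phi>). Re (F n (exp (Complex \<eta> \<phi>))))"
    proof (intro always_eventually allI)
      fix n
      have "continuous_on ({0..L} \<times> UNIV) (\<lambda>p. Re (F n (exp (of_real (fst p) + \<i> * of_real (snd p)))))"
        by (intro continuous_intros continuous_on_compose2[OF holomorphic_on_imp_continuous_on[OF FP(1)]]) auto
      then show "continuous_on ({0..L} \<times> UNIV) (\<lambda>(\<eta>, \<phi>). Re (F n (exp (Complex \<eta> \<phi>))))"
        by (simp add: split_beta' Complex_eq)
    qed
    show "uniform_limit ({0..L} \<times> UNIV) (\<lambda>n (\<eta>, \<phi>). Re (F n (exp (Complex \<eta> \<phi>))))
        (\<lambda>(\<eta>, \<phi>). if \<eta> < L then kernel_integral L h \<eta> \<phi> else h \<phi>) sequentially"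
    proof (rule uniform_limitI)
      fix e :: real assume "e > 0"
      then have "\<forall>\<^sub>F n in sequentially. 1 / real (Suc n) < e"
        using order_tendstoD(2)[OF lim_1_over_n[THEN LIMSEQ_Suc]] by simp
      then show "\<forall>\<^sub>F n in sequentially. \<forall>p\<in>{0..L} \<times> UNIV.
          dist (case p of (\<eta>, \<phi>) \<Rightarrow> Re (F n (exp (Complex \<eta> \<phi>))))
               (case p of (\<eta>, \<phi>) \<Rightarrow> if \<eta> < L then kernel_integral L h \<eta> \<phi> else h \<phi>) < e"
      proof eventually_elim
        case (elim n)
        have cP: "continuous_on UNIV (P n)" by (rule trig_polys_continuous[OF FP(2)])
        have "\<bar>Re (F n (exp (Complex \<eta> \<phi>))) - (if \<eta> < L then kernel_integral L h \<eta> \<phi> else h \<phi>)\<bar>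
            \<le> 1 / real (Suc n)" if "\<eta> \<in> {0..L}" for \<eta> \<phi>
        proof (cases "\<eta> < L")
          case True
          then have \<eta>: "\<eta> \<in> {0..<L}" using that by simp
          have "kernel_integral L (P n) \<eta> \<phi> = kernel_integral L (\<lambda>x. h x + (P n x - h x)) \<eta> \<phi>" by simp
          also have "\<dots> = kernel_integral L h \<eta> \<phi> + kernel_integral L (\<lambda>x. P n x - h x) \<eta> \<phi>"
            by (intro kernel_integral_add L continuous_intros h cP) (use \<eta> in auto)
          finally have "Re (F n (exp (Complex \<eta> \<phi>))) - kernel_integral L h \<eta> \<phi>
              = kernel_integral L (\<lambda>x. P n x - h x) \<eta> \<phi>"
            using FP(4)[OF \<eta>, of n \<phi>] by simp
          moreover have "\<bar>kernel_integral L (\<lambda>x. P n x - h x) \<eta> \<phi>\<bar> \<le> 1 / real (Suc n)"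
          proof (rule kernel_integral_bound[OF L])
            show "\<bar>P n x - h x\<bar> \<le> 1 / real (Suc n)" for x
              using FP(3)[of x n] by linarith
            show "P n (x + 2 * pi) - h (x + 2 * pi) = P n x - h x" for x
              using trig_polys_periodic[OF FP(2)] h(2) by simp
          qed (use \<eta> cP h(1) in \<open>auto intro!: continuous_intros\<close>)
          ultimately show ?thesis using True by simp
        next
          case False
          then have "\<eta> = L" using that by simp
          then show ?thesis using FP(3)[of \<phi> n] FP(5)[of n \<phi>] by (simp add: abs_minus_commute)
        qed
        then have "\<bar>Re (F n (exp (Complex \<eta> \<phi>))) - (if \<eta> < L then kernel_integral L h \<eta> \<phi> else h \<phi>)\<bar>
            < e" if "\<eta> \<in> {0..L}" for \<eta> \<phi>
          using elim that le_less_trans by blast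
        then show ?case unfolding dist_real_def by fast
      qed
    qed
  qed simp
qed

section \<open>The transform as the real part of a holomorphic function\<close>

text \<open>
  If \<open>F = u + \<i> v\<close> then \<open>F' = u\<^sub>\<eta> - \<i> u\<^sub>\<phi>\<close> by the Cauchy--Riemann equations. Applied to \<open>F\<close>, \<open>F'\<close> and
  \<open>\<i> F'\<close> this provides all partial derivatives in the definition of a classical solution.
\<close>

lemma holomorphic_partials:
  assumes F: "F holomorphic_on S" and S: "open S" and I: "\<And>\<eta> \<phi>. \<eta> \<in> I \<Longrightarrow> Complex \<eta> \<phi> \<in> S"
  shows "has_continuous_partials I (\<lambda>\<eta> \<phi>. Re (F (Complex \<eta> \<phi>)))
    (\<lambda>\<eta> \<phi>. Re (deriv F (Complex \<eta> \<phi>))) (\<lambda>\<eta> \<phi>. - Im (deriv F (Complex \<eta> \<phi>)))"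
proof -
  have F': "deriv F holomorphic_on S" by (rule holomorphic_deriv[OF F S])
  have cont: "continuous_on (I \<times> UNIV) (\<lambda>p. deriv F (of_real (fst p) + \<i> * of_real (snd p)))"
    by (intro continuous_on_compose2[OF holomorphic_on_imp_continuous_on[OF F']] continuous_intros)
       (use I in \<open>auto simp: Complex_eq\<close>)
  have dF: "(F has_field_derivative deriv F (Complex \<eta> \<phi>)) (at (Complex \<eta> \<phi>))" if "\<eta> \<in> I" for \<eta> \<phi>
    using holomorphic_derivI[OF F S I[OF that]] .
  show ?thesis
    unfolding has_continuous_partials_def
  proof (intro conjI ballI allI)
    fix \<eta> \<phi> assume \<eta>: "\<eta> \<in> I"
    have "((\<lambda>s. Complex s \<phi>) has_vector_derivative 1) (at \<eta> within I)"
      unfolding Complex_eq by (auto intro!: derivative_eq_intros)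
    from field_vector_diff_chain_within[OF this DERIV_subset[OF dF[OF \<eta>]]]
    show "((\<lambda>s. Re (F (Complex s \<phi>))) has_real_derivative Re (deriv F (Complex \<eta> \<phi>))) (at \<eta> within I)"
      unfolding has_real_derivative_iff_has_vector_derivative
      by (auto dest!: bounded_linear.has_vector_derivative[OF bounded_linear_Re] simp: o_def)
    have "((\<lambda>t. Complex \<eta> t) has_vector_derivative \<i>) (at \<phi>)"
      unfolding Complex_eq by (auto intro!: derivative_eq_intros)
    from field_vector_diff_chain_at[OF this dF[OF \<eta>]]
    show "((\<lambda>t. Re (F (Complex \<eta> t))) has_real_derivative - Im (deriv F (Complex \<eta> \<phi>))) (at \<phi>)"
      unfolding has_real_derivative_iff_has_vector_derivative
      by (auto dest!: bounded_linear.has_vector_derivative[OF bounded_linear_Re] simp: o_def)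
  next
    show "continuous_on (I \<times> UNIV) (\<lambda>(\<eta>, \<phi>). Re (deriv F (Complex \<eta> \<phi>)))"
      using continuous_on_Re[OF cont] by (simp add: split_beta' Complex_eq)
    show "continuous_on (I \<times> UNIV) (\<lambda>(\<eta>, \<phi>). - Im (deriv F (Complex \<eta> \<phi>)))"
      using continuous_on_minus[OF continuous_on_Im[OF cont]] by (simp add: split_beta' Complex_eq)
  qed
qed

lemma has_continuous_partials_cong:
  assumes "has_continuous_partials I f fx fy" "\<And>\<eta> \<phi>. \<eta> \<in> I \<Longrightarrow> f \<eta> \<phi> = g \<eta> \<phi>"
  shows "has_continuous_partials I g fx fy"
proof -
  have "((\<lambda>s. g s \<phi>) has_real_derivative fx \<eta> \<phi>) (at \<eta> within I)"
    if "\<eta> \<in> I" "((\<lambda>s. f s \<phi>) has_real_derivative fx \<eta> \<phi>) (at \<eta> within I)" for \<eta> \<phi>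
    by (rule has_field_derivative_transform_within[OF that(2) zero_less_one that(1)])
       (use assms(2) in auto)
  moreover have "f \<eta> = g \<eta>" if "\<eta> \<in> I" for \<eta> using assms(2)[OF that] by (rule ext)
  ultimately show ?thesis
    using assms(1) unfolding has_continuous_partials_def by auto
qed

lemma fourier_coeffs_bounded:
  assumes h: "continuous_on UNIV h"
  obtains B where "B > 0" "\<And>k. \<bar>fourier_cos h k\<bar> \<le> B" "\<And>k. \<bar>fourier_sin h k\<bar> \<le> B"
proof -
  have hc: "continuous_on {0..2 * pi} h" using h continuous_on_subset by blast
  then have "compact (h ` {0..2 * pi})" by (intro compact_continuous_image compact_Icc)
  then obtain M where M: "M > 0" "\<And>\<tau>. \<tau> \<in> {0..2 * pi} \<Longrightarrow> \<bar>h \<tau>\<bar> \<le> M"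
    by (metis (no_types, lifting) bounded_pos compact_imp_bounded image_eqI real_norm_def)
  have b: "\<bar>integral {0..2 * pi} (\<lambda>\<tau>. h \<tau> * t \<tau>)\<bar> \<le> M * (2 * pi)"
    if "continuous_on {0..2 * pi} t" "\<And>\<tau>. \<bar>t \<tau>\<bar> \<le> 1" for t
  proof -
    have "norm (integral {0..2 * pi} (\<lambda>\<tau>. h \<tau> * t \<tau>)) \<le> M * (2 * pi - 0)"
    proof (rule integral_bound)
      show "norm (h \<tau> * t \<tau>) \<le> M" if "\<tau> \<in> {0..2 * pi}" for \<tau>
        using mult_mono[OF M(2)[OF that] \<open>\<And>\<tau>. \<bar>t \<tau>\<bar> \<le> 1\<close>[of \<tau>]] M(1) by (simp add: abs_mult)
    qed (auto intro!: continuous_intros hc that(1))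
    then show ?thesis by simp
  qed
  show ?thesis
    by (rule that[of "M * (2 * pi)"])
       (auto simp: fourier_cos_def fourier_sin_def M(1) intro!: b continuous_intros)
qed

text \<open>
  The coefficients are chosen so that the real part of \<open>potential_coeff L h k * cosh (k z)\<close> is the \<open>k\<close>-th
  term of the transform. The sign of the imaginary part accounts for \<open>\<i>\<^sup>2 = - 1\<close>.
\<close>

definition potential_coeff :: "real \<Rightarrow> (real \<Rightarrow> real) \<Rightarrow> nat \<Rightarrow> complex" where
  "potential_coeff L h k = (if k = 0 then of_real (fourier_cos h 0 / (2 * pi))
     else Complex (fourier_cos h k / cosh (real k * L) / pi) (- (fourier_sin h k / sinh (real k * L) / pi)))"

lemma potential_coeff_bound:
  assumes L: "L > 0" and h: "continuous_on UNIV h"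
  obtains B where "\<And>k. norm (potential_coeff L h k) \<le> B * exp (- L) ^ k"
proof -
  obtain B where B: "B > 0" "\<And>k. \<bar>fourier_cos h k\<bar> \<le> B" "\<And>k. \<bar>fourier_sin h k\<bar> \<le> B"
    using fourier_coeffs_bounded[OF h] by blast
  define K where "K = B / (2 * pi) + 2 * (B * decay_const L / pi)"
  have p: "B * decay_const L / pi > 0" "B / (2 * pi) > 0"
    using B(1) decay_const_pos[OF L] by simp_all
  have "norm (potential_coeff L h k) \<le> K * exp (- L) ^ k" for k
  proof (cases "k = 0")
    case True
    have "\<bar>fourier_cos h 0\<bar> / (2 * pi) \<le> B / (2 * pi)"
      using B(2) by (intro divide_right_mono) auto
    moreover have "norm (potential_coeff L h 0) = \<bar>fourier_cos h 0\<bar> / (2 * pi)"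
    proof -
      have "potential_coeff L h 0 = of_real (fourier_cos h 0 / (2 * pi))"
        by (simp add: potential_coeff_def)
      then show ?thesis by (simp only: norm_of_real abs_divide) simp
    qed
    ultimately show ?thesis using p True by (simp add: K_def)
  next
    case False
    then have k: "k \<ge> 1" by simp
    have e: "exp (- real k * L) = exp (- L) ^ k" by (simp add: exp_of_nat_mult[symmetric])
    have t: "\<bar>x * y / pi\<bar> \<le> B * decay_const L / pi * exp (- L) ^ k"
      if "\<bar>x\<bar> \<le> B" "0 \<le> y" "y \<le> decay_const L * exp (- L) ^ k" for x y
    proof -
      have "\<bar>x\<bar> * y \<le> B * (decay_const L * exp (- L) ^ k)"
        using that B(1) by (intro mult_mono) auto
      then show ?thesis using that by (simp add: abs_mult field_simps)
    qed
    have "norm (potential_coeff L h k) \<le> \<bar>Re (potential_coeff L h k)\<bar> + \<bar>Im (potential_coeff L h k)\<bar>"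
      by (rule cmod_le)
    also have "\<bar>Re (potential_coeff L h k)\<bar> \<le> B * decay_const L / pi * exp (- L) ^ k"
      using t[OF B(2)[of k], of "1 / cosh (real k * L)"] inverse_sinh_cosh_le(1)[OF L k] False
      unfolding e by (simp add: potential_coeff_def)
    also have "\<bar>Im (potential_coeff L h k)\<bar> \<le> B * decay_const L / pi * exp (- L) ^ k"
      using t[OF B(3)[of k], of "1 / sinh (real k * L)"] inverse_sinh_cosh_le(2)[OF L k] False L
      unfolding e by (simp add: potential_coeff_def)
    finally have "norm (potential_coeff L h k) \<le> 2 * (B * decay_const L / pi) * exp (- L) ^ k" by simp
    also have "\<dots> \<le> K * exp (- L) ^ k"
      using p by (intro mult_right_mono) (auto simp: K_def)
    finally show ?thesis .
  qed
  then show ?thesis by (rule that)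
qed

definition potential_series :: "real \<Rightarrow> (real \<Rightarrow> real) \<Rightarrow> complex \<Rightarrow> complex" where
  "potential_series L h w = (\<Sum>k. potential_coeff L h k * w ^ k)"

lemma potential_series_sums:
  assumes L: "L > 0" and h: "continuous_on UNIV h" and w: "norm w < exp L"
  shows "(\<lambda>k. potential_coeff L h k * w ^ k) sums potential_series L h w"
proof -
  obtain B where B: "\<And>k. norm (potential_coeff L h k) \<le> B * exp (- L) ^ k"
    using potential_coeff_bound[OF L h] by blast
  have "exp (- L) * norm w < 1"
    using w by (simp add: exp_minus field_simps)
  then have "summable (\<lambda>k. B * (exp (- L) * norm w) ^ k)"
    by (intro summable_mult summable_geometric) simp
  moreover have "norm (potential_coeff L h k * w ^ k) \<le> B * (exp (- L) * norm w) ^ k" for k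
    using mult_right_mono[OF B[of k], of "norm w ^ k"]
    by (simp add: norm_mult norm_power power_mult_distrib mult.assoc)
  ultimately show ?thesis
    unfolding potential_series_def by (rule summable_sums[OF summable_comparison_test'])
qed

text \<open>
  Splitting \<open>cosh (k z)\<close> into the exponentials \<open>exp (\<plusminus> k z)\<close> makes the potential the mean of two values of one
  power series. The coefficients make it converge on the disc of radius \<open>exp L\<close>, and both arguments
  lie in this disc exactly for \<open>\<bar>Re z\<bar> < L\<close>. In this form the potential is manifestly even and periodic.
\<close>

definition complex_potential :: "real \<Rightarrow> (real \<Rightarrow> real) \<Rightarrow> complex \<Rightarrow> complex" where
  "complex_potential L h z = (potential_series L h (exp z) + potential_series L h (exp (- z))) / 2"

lemma open_strip: "open {z. \<bar>Re z\<bar> < L}"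
  by (intro open_Collect_less continuous_intros)

lemma complex_potential_holomorphic:
  assumes L: "L > 0" and h: "continuous_on UNIV h"
  shows "complex_potential L h holomorphic_on {z. \<bar>Re z\<bar> < L}"
proof -
  have hol: "potential_series L h holomorphic_on ball 0 (exp L)"
    by (rule power_series_holomorphic[of _ _ "potential_coeff L h"])
       (use potential_series_sums[OF L h] in auto)
  have "(\<lambda>z. potential_series L h (exp z)) holomorphic_on {z. \<bar>Re z\<bar> < L}"
    "(\<lambda>z. potential_series L h (exp (- z))) holomorphic_on {z. \<bar>Re z\<bar> < L}"
    by (rule holomorphic_on_compose_gen[OF _ hol, unfolded o_def]; force intro!: holomorphic_intros)+
  then show ?thesis
    unfolding complex_potential_def by (intro holomorphic_intros) auto
qed

lemma kernel_integral_eq_Re_potential: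
  assumes L: "L > 0" "0 \<le> \<eta>" "\<eta> < L" and h: "continuous_on UNIV h"
  shows "kernel_integral L h \<eta> \<phi> = Re (complex_potential L h (Complex \<eta> \<phi>))"
proof -
  let ?w = "exp (Complex \<eta> \<phi>)"
  let ?C = "\<lambda>k. Complex (cosh (real k * \<eta>) * cos (real k * \<phi>)) (sinh (real k * \<eta>) * sin (real k * \<phi>))"
  have "(\<lambda>k. (potential_coeff L h k * ?w ^ k + potential_coeff L h k * exp (- Complex \<eta> \<phi>) ^ k) / 2)
      sums complex_potential L h (Complex \<eta> \<phi>)"
    unfolding complex_potential_def
    by (intro sums_divide sums_add potential_series_sums L h) (use L in auto)
  moreover have "(potential_coeff L h k * ?w ^ k + potential_coeff L h k * exp (- Complex \<eta> \<phi>) ^ k) / 2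
      = potential_coeff L h k * ?C k" for k
    unfolding exp_power_mean[symmetric] exp_minus by (simp add: algebra_simps)
  ultimately have "(\<lambda>k. potential_coeff L h k * ?C k) sums complex_potential L h (Complex \<eta> \<phi>)"
    by simp
  then have "(\<lambda>k. Re (potential_coeff L h k * ?C k)) sums Re (complex_potential L h (Complex \<eta> \<phi>))"
    by (rule sums_Re)
  moreover have "Re (potential_coeff L h 0 * ?C 0) = fourier_cos h 0 / (2 * pi)"
    by (simp add: potential_coeff_def)
  ultimately have "(\<lambda>k. Re (potential_coeff L h (Suc k) * ?C (Suc k)))
      sums (Re (complex_potential L h (Complex \<eta> \<phi>)) - fourier_cos h 0 / (2 * pi))"
    using sums_Suc_iff[of "\<lambda>k. Re (potential_coeff L h k * ?C k)"] by (simp only: diff_add_cancel)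
  moreover have "Re (potential_coeff L h (Suc n) * ?C (Suc n)) =
      1 / pi * (cosh (real (Suc n) * \<eta>) / cosh (real (Suc n) * L) * cos (real (Suc n) * \<phi>) * fourier_cos h (Suc n)
                + sinh (real (Suc n) * \<eta>) / sinh (real (Suc n) * L) * sin (real (Suc n) * \<phi>) * fourier_sin h (Suc n))" for n
    by (simp add: potential_coeff_def algebra_simps add_divide_distrib del: of_nat_Suc)
  ultimately have "Re (complex_potential L h (Complex \<eta> \<phi>)) - fourier_cos h 0 / (2 * pi)
      = kernel_integral L h \<eta> \<phi> - fourier_cos h 0 / (2 * pi)"
    using sums_unique2[OF _ kernel_integral_sums[OF L h, of \<phi>]] by (simp only:)
  then show ?thesis by simp
qed

text \<open>
  The parity conditions come from \<open>F (- z) = F z\<close> and \<open>F' (- z) = - F' z\<close> on the imaginary axis. The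
  equation is \<open>Re F'' + Re (\<i> \<i> F'') = 0\<close>. Continuity up to \<open>\<eta> = L\<close> is
  \<open>kernel_integral_extends_continuously\<close>.
\<close>

lemma kernel_integral_classical_solution:
  assumes L: "L > 0" and h: "continuous_on UNIV h" "\<And>x. h (x + 2 * pi) = h x"
    and g: "\<And>\<eta> \<phi>. \<eta> \<in> {0..<L} \<Longrightarrow> g \<eta> \<phi> = kernel_integral L h \<eta> \<phi>" "\<And>\<phi>. g L \<phi> = h \<phi>"
  shows "classical_solution L h g"
proof -
  define F where "F = complex_potential L h"
  let ?S = "{z. \<bar>Re z\<bar> < L}"
  have F: "F holomorphic_on ?S" unfolding F_def by (rule complex_potential_holomorphic[OF L h(1)])
  have F': "deriv F holomorphic_on ?S" by (rule holomorphic_deriv[OF F open_strip])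
  have F'': "deriv (deriv F) holomorphic_on ?S" by (rule holomorphic_deriv[OF F' open_strip])
  have gF: "g \<eta> \<phi> = Re (F (Complex \<eta> \<phi>))" if "\<eta> \<in> {0..<L}" for \<eta> \<phi>
    using g(1)[OF that] kernel_integral_eq_Re_potential[OF L _ _ h(1)] that by (simp add: F_def)
  have F_even: "F (- z) = F z" for z
    by (simp add: F_def complex_potential_def add.commute)
  have F_per: "F (Complex \<eta> (\<phi> + 2 * pi)) = F (Complex \<eta> \<phi>)" for \<eta> \<phi>
  proof -
    have e: "exp (Complex \<eta> (\<phi> + 2 * pi)) = exp (Complex \<eta> \<phi>)"
      by (simp add: complex_eq_iff Re_exp Im_exp)
    then show ?thesis unfolding F_def complex_potential_def exp_minus by simp
  qed
  have iF': "(\<lambda>z. \<i> * deriv F z) holomorphic_on ?S" by (intro holomorphic_on_mult holomorphic_on_const F')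
  have diF': "deriv (\<lambda>z. \<i> * deriv F z) z = \<i> * deriv (deriv F) z" if "z \<in> ?S" for z
    using holomorphic_on_imp_differentiable_at[OF F' open_strip that] by (rule deriv_cmult)
  have mem: "Complex \<eta> \<phi> \<in> ?S" if "\<eta> \<in> {0..<L}" for \<eta> \<phi> using that by simp
  have mem': "Complex \<eta> \<phi> \<in> ?S" if "\<eta> \<in> {0<..<L}" for \<eta> \<phi> using that by simp
  show ?thesis
    unfolding classical_solution_def
  proof (intro exI conjI)
    have "continuous_on ({0..L} \<times> UNIV) (\<lambda>(\<eta>, \<phi>). if \<eta> < L then kernel_integral L h \<eta> \<phi> else h \<phi>)"
      by (rule kernel_integral_extends_continuously[OF L h])
    then show "continuous_on ({0..L} \<times> UNIV) (\<lambda>(\<eta>, \<phi>). g \<eta> \<phi>)"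
      by (rule continuous_on_eq) (use g in \<open>auto simp: not_less\<close>)
    show "\<forall>\<eta>\<in>{0..L}. \<forall>\<phi>. g \<eta> (\<phi> + 2 * pi) = g \<eta> \<phi>"
    proof (intro ballI allI)
      fix \<eta> \<phi> assume "\<eta> \<in> {0..L}"
      then have "\<eta> \<in> {0..<L} \<or> \<eta> = L" by auto
      then show "g \<eta> (\<phi> + 2 * pi) = g \<eta> \<phi>"
        using gF F_per g(2) h(2) by auto
    qed
    show "has_continuous_partials {0..<L} g
        (\<lambda>\<eta> \<phi>. Re (deriv F (Complex \<eta> \<phi>))) (\<lambda>\<eta> \<phi>. - Im (deriv F (Complex \<eta> \<phi>)))"
      by (rule has_continuous_partials_cong[OF holomorphic_partials[OF F open_strip mem]]) (use gF in auto)
    show "has_continuous_partials {0<..<L} (\<lambda>\<eta> \<phi>. Re (deriv F (Complex \<eta> \<phi>)))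
        (\<lambda>\<eta> \<phi>. Re (deriv (deriv F) (Complex \<eta> \<phi>))) (\<lambda>\<eta> \<phi>. - Im (deriv (deriv F) (Complex \<eta> \<phi>)))"
      by (rule holomorphic_partials[OF F' open_strip mem'])
    show "has_continuous_partials {0<..<L} (\<lambda>\<eta> \<phi>. - Im (deriv F (Complex \<eta> \<phi>)))
        (\<lambda>\<eta> \<phi>. Re (deriv (\<lambda>z. \<i> * deriv F z) (Complex \<eta> \<phi>)))
        (\<lambda>\<eta> \<phi>. - Im (deriv (\<lambda>z. \<i> * deriv F z) (Complex \<eta> \<phi>)))"
      by (rule has_continuous_partials_cong[OF holomorphic_partials[OF iF' open_strip mem']]) auto
    show "\<forall>\<eta>\<in>{0<..<L}. \<forall>\<phi>. Re (deriv (deriv F) (Complex \<eta> \<phi>))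
        + - Im (deriv (\<lambda>z. \<i> * deriv F z) (Complex \<eta> \<phi>)) = 0"
      using diF'[OF mem'] by simp
    show "\<forall>\<phi>. g L \<phi> = h \<phi>" using g(2) by blast
    have neg: "Complex 0 (- \<phi>) = - Complex 0 \<phi>" for \<phi> by (simp add: complex_eq_iff)
    show "\<forall>\<phi>. g 0 (- \<phi>) = g 0 \<phi>"
      using gF[of 0] L by (simp add: neg F_even)
    have "deriv F (- z) = - deriv F z" if z: "z \<in> ?S" for z
    proof -
      have "((\<lambda>z. F (- z)) has_field_derivative deriv F (- z) * - 1) (at z)"
        by (rule DERIV_chain2[OF holomorphic_derivI[OF F open_strip]])
           (use z in \<open>auto intro!: derivative_eq_intros\<close>)
      then have "(F has_field_derivative - deriv F (- z)) (at z)" by (simp add: F_even)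
      then show ?thesis using DERIV_imp_deriv by force
    qed
    from this[OF mem[of 0]]
    show "\<forall>\<phi>. Re (deriv F (Complex 0 (- \<phi>))) = - Re (deriv F (Complex 0 \<phi>))"
      unfolding neg using L by simp
  qed
qed

section \<open>The general solution\<close>

theorem theorem3:
  fixes R \<rho> a b q \<eta>hat :: real and h :: "real \<Rightarrow> real"
  assumes "R > 0" and "\<rho> \<in> {-1<..<1}" and "\<rho> \<noteq> 0"
    and "a = R / sqrt (1 - \<bar>\<rho>\<bar>)" and "b = R / sqrt (1 + \<bar>\<rho>\<bar>)"
    and "q = sqrt ((a - b) / (a + b))" and "\<eta>hat = - ln q"
    and "continuous_on UNIV h" and "\<forall>x. h (x + 2 * pi) = h x"
  shows "q \<in> {0<..<1} \<and> \<eta>hat > 0 \<and>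
    (\<forall>\<eta>\<in>{0..<\<eta>hat}. \<forall>\<phi> \<tau>. summable (\<lambda>n. kernel_term \<eta>hat \<eta> \<phi> \<tau> (Suc n))) \<and>
    (\<forall>\<eta>\<in>{0..<\<eta>hat}. \<forall>\<phi>. (\<lambda>\<tau>. h \<tau> * strip_kernel \<eta>hat \<eta> \<phi> \<tau>) integrable_on {0..2 * pi}) \<and>
    (\<forall>g. classical_solution \<eta>hat h g \<longleftrightarrow>
       (\<forall>\<eta>\<in>{0..<\<eta>hat}. \<forall>\<phi>. g \<eta> \<phi> = integral {0..2 * pi} (\<lambda>\<tau>. h \<tau> * strip_kernel \<eta>hat \<eta> \<phi> \<tau>)) \<and>
       (\<forall>\<phi>. g \<eta>hat \<phi> = h \<phi>))"
proof -
  note h = \<open>continuous_on UNIV h\<close> \<open>\<forall>x. h (x + 2 * pi) = h x\<close>[rule_format]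
  have r: "0 < \<bar>\<rho>\<bar>" "\<bar>\<rho>\<bar> < 1" using assms(2,3) by auto
  have b: "b > 0" unfolding assms(5) using assms(1) by simp
  have ab: "b < a" unfolding assms(4,5)
    using r assms(1) by (intro divide_strict_left_mono) auto
  have "0 < (a - b) / (a + b)" "(a - b) / (a + b) < 1" using b ab by auto
  then have q: "q \<in> {0<..<1}" unfolding assms(6) by simp
  then have L: "\<eta>hat > 0" unfolding assms(7) by simp
  have "classical_solution \<eta>hat h g \<longleftrightarrow>
      (\<forall>\<eta>\<in>{0..<\<eta>hat}. \<forall>\<phi>. g \<eta> \<phi> = kernel_integral \<eta>hat h \<eta> \<phi>) \<and> (\<forall>\<phi>. g \<eta>hat \<phi> = h \<phi>)" for g
  proof
    assume g: "classical_solution \<eta>hat h g"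
    \<comment> \<open>By linearity and uniqueness for zero data, \<open>g\<close> is the solution given by the formula.\<close>
    define g0 where "g0 = (\<lambda>\<eta> \<phi>. if \<eta> < \<eta>hat then kernel_integral \<eta>hat h \<eta> \<phi> else h \<phi>)"
    have "classical_solution \<eta>hat h g0"
      by (rule kernel_integral_classical_solution[OF L h]) (auto simp: g0_def)
    from classical_solution_diff[OF g this]
    have "classical_solution \<eta>hat (\<lambda>_. 0) (\<lambda>\<eta> \<phi>. g \<eta> \<phi> - g0 \<eta> \<phi>)" by simp
    from classical_solution_zero[OF L this] 
    have "g \<eta> \<phi> = g0 \<eta> \<phi>" if "\<eta> \<in> {0..\<eta>hat}" for \<eta> \<phi> using that by simp
    then show "(\<forall>\<eta>\<in>{0..<\<eta>hat}. \<forall>\<phi>. g \<eta> \<phi> = kernel_integral \<eta>hat h \<eta> \<phi>) \<and> (\<forall>\<phi>. g \<eta>hat \<phi> = h \<phi>)"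
      using L by (auto simp: g0_def)
  next
    assume "(\<forall>\<eta>\<in>{0..<\<eta>hat}. \<forall>\<phi>. g \<eta> \<phi> = kernel_integral \<eta>hat h \<eta> \<phi>) \<and> (\<forall>\<phi>. g \<eta>hat \<phi> = h \<phi>)"
    then show "classical_solution \<eta>hat h g"
      by (intro kernel_integral_classical_solution[OF L h]) auto
  qed
  then show ?thesis
    unfolding kernel_integral_def[symmetric]
    using q L kernel_summable[OF L] kernel_integrable[OF L _ _ h(1)] by auto
qed

end
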